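(* Let $X$ be a separable complex Banach space and let $(T_t)_{t\ge 0}$ be a $C_0$-semigroup on $X$ with generator $A$. Assume that there exists a family $(f_j)_{j\in\Gamma}$ of locally bounded measurable maps $f_j:I_j\to X$ such that, for every $j\in\Gamma$, $I_j$ is an interval in $\mathbb{R}$, $Af_j(t)=it\,f_j(t)$ for every $t\in I_j$ (in particular $f_j(t)\in D(A)$), and $\operatorname{span}\{f_j(t) : j\in\Gamma,\ t\in I_j\}$ is dense in $X$. If either (a) $f_j\in C^2(I_j,X)$ for every $j\in\Gamma$, or (b) $X$ does not contain $c_0$, and for every $\varphi\in X'$ and every $j\in\Gamma$ the map $\langle\varphi,f_j\rangle : t\mapsto\langle\varphi,f_j(t)\rangle$ belongs to $C^1(I_j)$, then $(T_t)_{t\ge 0}$ is frequently hypercyclic.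
   Context: A $C_0$-semigroup is a strongly continuous one-parameter semigroup of continuous linear operators; $D(A)$ denotes the domain of its generator $A$. $X'$ is the topological dual of $X$. "$X$ does not contain $c_0$" means that no closed subspace of $X$ is isomorphic to $c_0$. Intervals are understood to be nondegenerate (with nonempty interior). The lower density of a measurable set $M\subset\mathbb{R}_+$ is $\underline{\mathrm{Dens}}(M):=\liminf_{N\to\infty}\mu(M\cap[0,N])/N$, where $\mu$ is Lebesgue measure. A $C_0$-semigroup $(T_t)_{t\ge 0}$ on $X$ is frequently hypercyclic if there exists $x\in X$ such that $\underline{\mathrm{Dens}}(\{t\in\mathbb{R}_+ : T_tx\in U\})>0$ for every non-empty open set $U\subset X$. *)

theory Defs
  imports "HOL-Analysis.Analysis"
begin

text \<open>The distribution provides only real normed spaces as type classes. A complex normed space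
  is a real one with a compatible complex scalar multiplication.\<close>

class complex_vector = real_vector +
  fixes scaleC :: "complex \<Rightarrow> 'a \<Rightarrow> 'a"  (infixr \<open>*\<^sub>C\<close> 75)
  assumes scaleC_add_right: "a *\<^sub>C (x + y) = a *\<^sub>C x + a *\<^sub>C y"
    and scaleC_add_left: "(a + b) *\<^sub>C x = a *\<^sub>C x + b *\<^sub>C x"
    and scaleC_scaleC: "a *\<^sub>C (b *\<^sub>C x) = (a * b) *\<^sub>C x"
    and scaleC_of_real: "complex_of_real r *\<^sub>C x = r *\<^sub>R x"

class complex_normed_vector = complex_vector + real_normed_vector +
  assumes norm_scaleC: "norm (a *\<^sub>C x) = cmod a * norm x"

class complex_banach = complex_normed_vector + banach

global_interpretation complex_vector: vector_space "scaleC :: complex \<Rightarrow> 'a \<Rightarrow> 'a::complex_vector"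
  defines csubspace = complex_vector.subspace
    and cspan = complex_vector.span
proof
  show "1 *\<^sub>C x = x" for x :: 'a
    using scaleC_of_real[of 1 x] by simp
qed (simp_all add: scaleC_add_right scaleC_add_left scaleC_scaleC)

instantiation complex :: complex_banach
begin

definition scaleC_complex :: "complex \<Rightarrow> complex \<Rightarrow> complex"
  where "scaleC_complex a z = a * z"

instance
  by standard
    (simp_all add: scaleC_complex_def algebra_simps norm_mult scaleR_conv_of_real)

end

instantiation bcontfun :: (topological_space, complex_normed_vector) complex_normed_vector
begin

definition scaleC_bcontfun :: "complex \<Rightarrow> ('a \<Rightarrow>\<^sub>C 'b) \<Rightarrow> 'a \<Rightarrow>\<^sub>C 'b"
  where "scaleC_bcontfun c g = Bcontfun (\<lambda>x. c *\<^sub>C apply_bcontfun g x)"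

lemma apply_bcontfun_scaleC:
  fixes g :: "'a \<Rightarrow>\<^sub>C 'b"
  shows "apply_bcontfun (c *\<^sub>C g) x = c *\<^sub>C apply_bcontfun g x"
proof -
  have lin: "bounded_linear (\<lambda>y::'b. c *\<^sub>C y)"
  proof (rule bounded_linear_intro[where K = "cmod c"])
    show "c *\<^sub>C (r *\<^sub>R y) = r *\<^sub>R (c *\<^sub>C y)" for r and y :: 'b
      by (simp add: scaleC_of_real[symmetric] scaleC_scaleC mult.commute)
  qed (simp_all add: scaleC_add_right norm_scaleC mult.commute)
  have "bounded ((\<lambda>y. c *\<^sub>C y) ` range (apply_bcontfun g))"
    by (intro bounded_linear_image lin) simp
  then have "(\<lambda>x. c *\<^sub>C apply_bcontfun g x) \<in> bcontfun"
    using bounded_linear.continuous_on[OF lin continuous_on_apply_bcontfun[of UNIV g]]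
    by (simp add: bcontfun_def image_image)
  then show ?thesis
    by (simp add: scaleC_bcontfun_def Bcontfun_inverse)
qed

instance
proof
  fix a b :: complex and r :: real and x y :: "'a \<Rightarrow>\<^sub>C 'b"
  show "a *\<^sub>C (x + y) = a *\<^sub>C x + a *\<^sub>C y"
    by (rule bcontfun_eqI) (simp add: apply_bcontfun_scaleC scaleC_add_right)
  show "(a + b) *\<^sub>C x = a *\<^sub>C x + b *\<^sub>C x"
    by (rule bcontfun_eqI) (simp add: apply_bcontfun_scaleC scaleC_add_left)
  show "a *\<^sub>C (b *\<^sub>C x) = (a * b) *\<^sub>C x"
    by (rule bcontfun_eqI) (simp add: apply_bcontfun_scaleC scaleC_scaleC)
  show "complex_of_real r *\<^sub>C x = r *\<^sub>R x"
    by (rule bcontfun_eqI) (simp add: apply_bcontfun_scaleC scaleC_of_real)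
  have le: "norm (c *\<^sub>C z) \<le> cmod c * norm z" for c and z :: "'a \<Rightarrow>\<^sub>C 'b"
    by (rule norm_bound)
      (simp add: apply_bcontfun_scaleC norm_scaleC mult_left_mono norm_bounded)
  show "norm (a *\<^sub>C x) = cmod a * norm x"
  proof (cases "a = 0")
    case True
    then show ?thesis
      using le[of 0 x] by simp
  next
    case False
    have "inverse a *\<^sub>C (a *\<^sub>C x) = x"
      using False by (intro bcontfun_eqI)
        (simp add: apply_bcontfun_scaleC complex_vector.scale_scale)
    then have "norm x \<le> inverse (cmod a) * norm (a *\<^sub>C x)"
      using le[of "inverse a" "a *\<^sub>C x"] by (simp add: norm_inverse)
    then have "cmod a * norm x \<le> norm (a *\<^sub>C x)"
      using False by (simp add: field_simps)
    with le[of a x] show ?thesis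
      by simp
  qed
qed

end

definition bounded_clinear :: "('a::complex_normed_vector \<Rightarrow> 'b::complex_normed_vector) \<Rightarrow> bool"
  where "bounded_clinear L \<longleftrightarrow> bounded_linear L \<and> (\<forall>c x. L (c *\<^sub>C x) = c *\<^sub>C L x)"

definition dual :: "('a::complex_normed_vector \<Rightarrow> complex) set"
  where "dual = {\<phi>. bounded_clinear \<phi>}"

text \<open>Since \<^typ>\<open>nat\<close> carries the discrete topology, \<^typ>\<open>nat \<Rightarrow>\<^sub>C complex\<close> is the space of
  bounded complex sequences with the supremum norm.\<close>

definition c0 :: "(nat \<Rightarrow>\<^sub>C complex) set"
  where "c0 = {x. (\<lambda>n. apply_bcontfun x n) \<longlonglongrightarrow> 0}"

definition isomorphic_subspaces ::
    "'a::complex_normed_vector set \<Rightarrow> 'b::complex_normed_vector set \<Rightarrow> bool"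
  where "isomorphic_subspaces Y Z \<longleftrightarrow>
    (\<exists>J K. homeomorphism Y Z J K \<and>
      (\<forall>x\<in>Y. \<forall>y\<in>Y. J (x + y) = J x + J y) \<and>
      (\<forall>c. \<forall>x\<in>Y. J (c *\<^sub>C x) = c *\<^sub>C J x))"

definition contains_c0 :: "'a::complex_normed_vector itself \<Rightarrow> bool"
  where "contains_c0 _ \<longleftrightarrow>
    (\<exists>Y::'a set. csubspace Y \<and> closed Y \<and> isomorphic_subspaces Y c0)"

text \<open>Semigroups are indexed by \<^typ>\<open>real\<close>; values at negative times are irrelevant.\<close>

definition C0_semigroup :: "(real \<Rightarrow> 'a::complex_normed_vector \<Rightarrow> 'a) \<Rightarrow> bool"
  where "C0_semigroup T \<longleftrightarrow>
    (\<forall>t\<ge>0. bounded_clinear (T t)) \<and>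
    T 0 = id \<and>
    (\<forall>s\<ge>0. \<forall>t\<ge>0. T (s + t) = T s \<circ> T t) \<and>
    (\<forall>x. continuous_on {0..} (\<lambda>t. T t x))"

definition generator_domain :: "(real \<Rightarrow> 'a::complex_normed_vector \<Rightarrow> 'a) \<Rightarrow> 'a set"
  where "generator_domain T =
    {x. \<exists>y. ((\<lambda>h. (T h x - x) /\<^sub>R h) \<longlongrightarrow> y) (at_right 0)}"

text \<open>Only meaningful on \<^const>\<open>generator_domain\<close>.\<close>

definition generator :: "(real \<Rightarrow> 'a::complex_normed_vector \<Rightarrow> 'a) \<Rightarrow> 'a \<Rightarrow> 'a"
  where "generator T x = Lim (at_right 0) (\<lambda>h. (T h x - x) /\<^sub>R h)"

definition lower_density :: "real set \<Rightarrow> ereal"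
  where "lower_density M = Liminf at_top (\<lambda>N::real. ereal (measure lebesgue (M \<inter> {0..N}) / N))"

definition frequently_hypercyclic :: "(real \<Rightarrow> 'a::complex_normed_vector \<Rightarrow> 'a) \<Rightarrow> bool"
  where "frequently_hypercyclic T \<longleftrightarrow>
    (\<exists>x. \<forall>U. open U \<and> U \<noteq> {} \<longrightarrow> lower_density {t. 0 \<le> t \<and> T t x \<in> U} > 0)"

definition nondegenerate_interval :: "real set \<Rightarrow> bool"
  where "nondegenerate_interval I \<longleftrightarrow> is_interval I \<and> interior I \<noteq> {}"

definition locally_bounded_on :: "real set \<Rightarrow> (real \<Rightarrow> 'a::real_normed_vector) \<Rightarrow> bool"
  where "locally_bounded_on I g \<longleftrightarrow> (\<forall>t\<in>I. \<exists>e>0. bounded (g ` (I \<inter> ball t e)))"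

text \<open>Derivatives are taken within \<open>I\<close>, hence one-sided at endpoints belonging to \<open>I\<close>; values
  outside \<open>I\<close> play no role.\<close>

primrec Ck_on :: "nat \<Rightarrow> real set \<Rightarrow> (real \<Rightarrow> 'a::real_normed_vector) \<Rightarrow> bool"
  where
    "Ck_on 0 I g \<longleftrightarrow> continuous_on I g"
  | "Ck_on (Suc k) I g \<longleftrightarrow>
      (\<exists>g'. (\<forall>t\<in>I. (g has_vector_derivative g' t) (at t within I)) \<and> Ck_on k I g')"

end

theory Submission
  imports Defs
begin

text \<open>A vector \<open>f(s)\<close> with \<open>A f(s) = i s f(s)\<close> satisfies \<open>T\<^sub>1 f(s) = e\<^sup>i\<^sup>s f(s)\<close>
  (\<open>generator_eigenvector_orbit\<close>). Hence, for a smooth weight \<open>w\<close> vanishing at the ends of a compact interval \<open>[a,b]\<close> of eigenvalue parameters,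
  the wave packets \<open>\<psi>(n) = \<integral> e\<^sup>i\<^sup>n\<^sup>s w(s) f(s) ds\<close>, with \<open>n\<close> an integer, form a two-sided orbit of \<open>T\<^sub>1\<close>: they are the
  Fourier coefficients of \<open>w f\<close>, and \<open>T\<^sub>1\<close> shifts them. Smoothness of \<open>f\<close> makes them decay.

  If \<open>f\<close> is \<open>C\<^sup>2\<close>, two integrations by parts give \<open>\<parallel>\<psi>(n)\<parallel> \<le> K / n\<^sup>2\<close>. If \<open>f\<close> is weakly \<open>C\<^sup>1\<close>, the
  Fourier coefficients of each \<open>\<phi> \<circ> w f\<close> are absolutely summable, because those of its derivative are square
  summable; so \<open>\<psi>\<close> is a weakly unconditionally Cauchy series, and in a space that does not contain \<open>c\<^sub>0\<close> such a
  series converges unconditionally (\<open>bessaga_pelczynski\<close>). In both cases \<open>\<psi>(0)\<close> lies on a two-sided orbit with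
  unconditionally small tails. The points with this property form a complex subspace
  (\<open>summable_orbit_points\<close>). Since \<open>f\<close> is continuous, which in the weak case follows from the uniform
  boundedness principle, normalised packets over short intervals at \<open>t\<close> tend to \<open>f(t)\<close>, so this subspace is
  dense.

  Density of that subspace suffices (\<open>frequently_hypercyclic_criterion\<close>). Let \<open>\<psi>\<^sub>l\<close> be such orbits whose points
  \<open>\<psi>\<^sub>l(0)\<close> form a dense sequence in which every entry recurs, and let \<open>A\<^sub>l\<close> be disjoint sets of
  natural numbers of positive lower density that lie far apart from each other. The vector
  \<open>x = \<Sum>\<^sub>l \<Sum>\<^sub>n\<^sub>\<in>\<^sub>A\<^sub>l \<psi>\<^sub>l(-n)\<close> satisfies, for \<open>m \<in> A\<^sub>l\<close>, that \<open>T\<^sub>m x\<close> is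
  \<open>\<psi>\<^sub>l(0)\<close> plus a sum over indices of large modulus, which is small. By local equicontinuity, a visit of the
  orbit at an integer time lasts for a fixed positive time, so the integer visits give positive lower density in
  continuous time.\<close>


section \<open>Uniform boundedness, norming functionals and weakly bounded sets\<close>

text \<open>By Baire, one of the closed sets on which all operators are bounded by \<open>k\<close> contains a ball. Differences
  of points of this ball fill a ball around the origin, which bounds the operator norms.\<close>

lemma uniform_boundedness:
  fixes L :: "'i \<Rightarrow> 'x::banach \<Rightarrow> 'y::real_normed_vector"
  assumes lin: "\<And>i. i \<in> A \<Longrightarrow> bounded_linear (L i)"
    and ptwise: "\<And>x. \<exists>B. \<forall>i\<in>A. norm (L i x) \<le> B"
  shows "\<exists>C\<ge>0. \<forall>i\<in>A. \<forall>x. norm (L i x) \<le> C * norm x"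
proof -
  define S where "S k = {x. \<forall>i\<in>A. norm (L i x) \<le> real k}" for k
  have S_closed: "closed (S k)" for k
  proof -
    have "S k = (\<Inter>i\<in>A. {x. norm (L i x) \<le> real k})"
      by (auto simp: S_def)
    moreover have "closed {x. norm (L i x) \<le> real k}" if "i \<in> A" for i
      using lin[OF that]
      by (intro closed_Collect_le continuous_intros linear_continuous_on)
    ultimately show ?thesis by auto
  qed
  have cover: "\<Union>(range S) = UNIV"
  proof -
    have "x \<in> \<Union>(range S)" for x
    proof -
      obtain B where "\<forall>i\<in>A. norm (L i x) \<le> B" using ptwise by blast
      moreover obtain k where "B \<le> real k" using real_arch_simple by blast
      ultimately have "x \<in> S k" unfolding S_def by (blast intro: order_trans)
      then show ?thesis by blast
    qed
    then show ?thesis by auto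
  qed
  obtain k where k: "interior (S k) \<noteq> {}"
  proof (rule ccontr)
    assume "\<not> thesis"
    then have "\<And>k. interior (S k) = {}" using that by blast
    then have "euclidean interior_of \<Union>(range S) = {}"
      using completely_metrizable_space_euclidean S_closed
      by (intro Baire_category_alt) auto
    then show False
      by (simp add: cover)
  qed
  then obtain c r where r: "r > 0" "cball c r \<subseteq> S k"
    by (meson ex_in_conv mem_interior_cball)
  show ?thesis
  proof (intro exI[of _ "2 * real k / r"] conjI ballI allI)
    fix i x assume i: "i \<in> A"
    interpret bounded_linear "L i" by (rule lin[OF i])
    show "norm (L i x) \<le> 2 * real k / r * norm x"
    proof (cases "x = 0")
      case False
      define y where "y = (r / norm x) *\<^sub>R x"
      have "norm y = r" using False r by (simp add: y_def)
      then have "c + y \<in> S k" "c \<in> S k" using r by (auto simp: dist_norm subset_iff)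
      then have "norm (L i (c + y)) \<le> real k" "norm (L i c) \<le> real k" using i by (auto simp: S_def)
      moreover have "L i y = L i (c + y) - L i c" by (simp add: add)
      ultimately have "norm (L i y) \<le> 2 * real k"
        using norm_triangle_ineq4[of "L i (c + y)" "L i c"] by simp
      then have "r / norm x * norm (L i x) \<le> 2 * real k"
        using r by (simp add: y_def scaleR)
      then show ?thesis using r False by (simp add: field_simps)
    qed (simp add: zero)
  qed (use r in simp)
qed

text \<open>Linear functionals of norm at most one are found as the minimal elements of this class. Domination by the norm
  bounds the members of the class from below, so that infima of chains exist.\<close>

definition norm_dominated_sublinear :: "('x::real_normed_vector \<Rightarrow> real) \<Rightarrow> bool"
  where "norm_dominated_sublinear p \<longleftrightarrow>
    (\<forall>x y. p (x + y) \<le> p x + p y) \<and> (\<forall>r>0. \<forall>x. p (r *\<^sub>R x) = r * p x) \<and>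
    (\<forall>x. p x \<le> norm x)"

lemma sublinear_zero:
  assumes "norm_dominated_sublinear p"
  shows "p 0 = 0"
proof -
  have "p (2 *\<^sub>R 0) = 2 * p 0"
    using assms unfolding norm_dominated_sublinear_def by (metis zero_less_numeral)
  then show ?thesis by simp
qed

lemma sublinear_lower:
  assumes p: "norm_dominated_sublinear p"
  shows "- norm x \<le> p x"
proof -
  have "p (x + - x) \<le> p x + p (- x)" "p (- x) \<le> norm (- x)"
    using p unfolding norm_dominated_sublinear_def by blast+
  then show ?thesis using sublinear_zero[OF p] by simp
qed

text \<open>The functional \<open>q(y) = inf {p(y + t x) - t p(x) | t \<ge> 0}\<close> is lowered in the
  direction \<open>-x\<close>: the choice \<open>y = -x\<close>, \<open>t = 1\<close> gives \<open>q(-x) \<le> - p(x)\<close>. When \<open>p\<close> is minimal,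
  \<open>q = p\<close>, and the bound for \<open>t = 1\<close> says that \<open>p\<close> is superadditive.\<close>

lemma sublinear_tilt:
  assumes p: "norm_dominated_sublinear p"
  obtains q where "norm_dominated_sublinear q" "\<And>y. q y \<le> p y" "\<And>y t. t \<ge> 0 \<Longrightarrow> q y \<le> p (y + t *\<^sub>R x) - t * p x"
proof -
  have add: "p (y + z) \<le> p y + p z" and hom: "r > 0 \<Longrightarrow> p (r *\<^sub>R y) = r * p y"
    and le: "p y \<le> norm y" for y z r
    using p by (auto simp: norm_dominated_sublinear_def)
  have hom0: "r \<ge> 0 \<Longrightarrow> p (r *\<^sub>R y) = r * p y" for r y
    using hom sublinear_zero[OF p] by (cases "r = 0") auto
  define g where "g y t = p (y + t *\<^sub>R x) - t * p x" for y t
  define q where "q y = (INF t\<in>{0..}. g y t)" for y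
  have low: "- norm y \<le> g y t" if "t \<ge> 0" for y t
  proof -
    have "t * p x \<le> p (y + t *\<^sub>R x) + p (- y)"
      using add[of "y + t *\<^sub>R x" "- y"] hom0[OF that, of x] by simp
    then show ?thesis using le[of "- y"] by (simp add: g_def)
  qed
  then have bdd: "bdd_below (g y ` {0..})" for y by (intro bdd_belowI2[of _ "- norm y"]) auto
  have q_le: "q y \<le> g y t" if "t \<ge> 0" for y t
    unfolding q_def by (rule cINF_lower[OF bdd]) (use that in auto)
  have q_p: "q y \<le> p y" for y using q_le[of 0 y] by (simp add: g_def)
  have q_ge: "(\<And>t. t \<ge> 0 \<Longrightarrow> c \<le> g y t) \<Longrightarrow> c \<le> q y" for c y
    unfolding q_def by (rule cINF_greatest) auto
  have q_add: "q (y + z) \<le> q y + q z" for y z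
  proof -
    have "q (y + z) \<le> g y s + g z t" if "s \<ge> 0" "t \<ge> 0" for s t
    proof -
      have "q (y + z) \<le> g (y + z) (s + t)" using q_le that by simp
      also have "\<dots> \<le> g y s + g z t"
        using add[of "y + s *\<^sub>R x" "z + t *\<^sub>R x"] by (simp add: g_def algebra_simps)
      finally show ?thesis .
    qed
    then have "q (y + z) - g z t \<le> q y" if "t \<ge> 0" for t
      using that by (intro q_ge) (simp add: algebra_simps)
    then have "q (y + z) - q y \<le> q z" by (intro q_ge) (simp add: algebra_simps)
    then show ?thesis by simp
  qed
  have half: "r * q y \<le> q (r *\<^sub>R y)" if r: "r > 0" for r y
  proof (rule q_ge)
    fix t :: real assume t: "t \<ge> 0"
    have "q y \<le> g y (t / r)" using q_le r t by simp
    then have "r * q y \<le> r * g y (t / r)" using r by simp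
    also have "\<dots> = g (r *\<^sub>R y) t"
      using r hom[OF r, of "y + (t / r) *\<^sub>R x"] by (simp add: g_def algebra_simps)
    finally show "r * q y \<le> g (r *\<^sub>R y) t" .
  qed
  have q_hom: "q (r *\<^sub>R y) = r * q y" if r: "r > 0" for r y
  proof (rule antisym)
    show "q (r *\<^sub>R y) \<le> r * q y"
      using half[of "inverse r" "r *\<^sub>R y"] r by (simp add: field_simps)
  qed (rule half[OF r])
  show thesis
  proof
    show "norm_dominated_sublinear q"
      unfolding norm_dominated_sublinear_def using q_add q_hom order_trans[OF q_p le] by blast
  qed (use q_p q_le in \<open>auto simp: g_def\<close>)
qed

text \<open>Zorn's lemma, downwards: the pointwise infimum of a chain is subadditive because two members of a chain can be
  replaced by the smaller one.\<close>

lemma minimal_sublinear: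
  assumes p: "norm_dominated_sublinear p"
  obtains m where "norm_dominated_sublinear m" "\<And>y. m y \<le> p y"
    "\<And>q. norm_dominated_sublinear q \<Longrightarrow> (\<And>y. q y \<le> m y) \<Longrightarrow> q = m"
proof -
  define A where "A = {q. norm_dominated_sublinear q \<and> (\<forall>y. q y \<le> p y)}"
  define R where "R = (\<lambda>q r :: 'a \<Rightarrow> real. \<forall>y. r y \<le> q y)"
  have po: "partial_order_on A (relation_of R A)"
    by (rule partial_order_on_relation_ofI) (auto simp: R_def fun_eq_iff intro: order_trans antisym)
  have "\<exists>m\<in>A. \<forall>a\<in>A. R m a \<longrightarrow> a = m"
  proof (rule predicate_Zorn[OF po])
    fix C assume C: "C \<in> Chains (relation_of R A)"
    then have CA: "C \<subseteq> A" by (rule Chains_relation_of)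
    have tot: "R q r \<or> R r q" if "q \<in> C" "r \<in> C" for q r
      using C that by (auto simp: Chains_def relation_of_def)
    show "\<exists>u\<in>A. \<forall>a\<in>C. R a u"
    proof (cases "C = {}")
      case True then show ?thesis using p by (auto simp: A_def)
    next
      case ne: False
      have S: "norm_dominated_sublinear q" if "q \<in> C" for q using that CA by (auto simp: A_def)
      define u where "u y = (INF q\<in>C. q y)" for y
      have bdd: "bdd_below ((\<lambda>q. q y) ` C)" for y
        using S sublinear_lower by (intro bdd_belowI2[of _ "- norm y"]) auto
      have u_le: "u y \<le> q y" if "q \<in> C" for q y
        unfolding u_def by (rule cINF_lower[OF bdd that])
      have u_ge: "(\<And>q. q \<in> C \<Longrightarrow> c \<le> q y) \<Longrightarrow> c \<le> u y" for c y
        unfolding u_def by (rule cINF_greatest[OF ne])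
      have u_add: "u (y + z) \<le> u y + u z" for y z
      proof -
        have "u (y + z) \<le> q y + r z" if qr: "q \<in> C" "r \<in> C" for q r
        proof -
          obtain s where s: "s \<in> C" "s y \<le> q y" "s z \<le> r z"
            using tot[OF qr] qr unfolding R_def by blast
          have "s (y + z) \<le> s y + s z" using S[OF s(1)] by (simp add: norm_dominated_sublinear_def)
          then show ?thesis using u_le[OF s(1), of "y + z"] s(2,3) by linarith
        qed
        then have "u (y + z) - r z \<le> u y" if "r \<in> C" for r
          using that by (intro u_ge) (simp add: algebra_simps)
        then have "u (y + z) - u y \<le> u z" by (intro u_ge) (simp add: algebra_simps)
        then show ?thesis by simp
      qed
      have half: "r * u y \<le> u (r *\<^sub>R y)" if r: "r > 0" for r y
      proof (rule u_ge)
        fix q assume q: "q \<in> C"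
        then have "q (r *\<^sub>R y) = r * q y" using S r by (auto simp: norm_dominated_sublinear_def)
        then show "r * u y \<le> q (r *\<^sub>R y)" using u_le[OF q] r by simp
      qed
      have u_hom: "u (r *\<^sub>R y) = r * u y" if r: "r > 0" for r y
      proof (rule antisym)
        show "u (r *\<^sub>R y) \<le> r * u y"
          using half[of "inverse r" "r *\<^sub>R y"] r by (simp add: field_simps)
      qed (rule half[OF r])
      obtain q where q: "q \<in> C" using ne by blast
      have up: "u y \<le> p y" for y 
      proof -
        have "q y \<le> p y" using q CA by (auto simp: A_def)
        then show ?thesis using u_le[OF q, of y] by linarith
      qed
      have un: "u y \<le> norm y" for y 
      proof -
        have "q y \<le> norm y" using S[OF q] by (simp add: norm_dominated_sublinear_def)
        then show ?thesis using u_le[OF q, of y] by linarith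
      qed
      have "u \<in> A" using u_add u_hom un up by (auto simp: A_def norm_dominated_sublinear_def)
      then show ?thesis using u_le by (auto simp: R_def)
    qed
  qed
  then obtain m where m: "m \<in> A" "\<And>a. a \<in> A \<Longrightarrow> R m a \<Longrightarrow> a = m" by blast
  show thesis
  proof
    show "q = m" if "norm_dominated_sublinear q" "\<And>y. q y \<le> m y" for q
    proof (rule m(2))
      have "q y \<le> p y" for y
        using that(2)[of y] m(1) order_trans[of "q y" "m y" "p y"] by (auto simp: A_def)
      then show "q \<in> A" using that(1) by (simp add: A_def)
      show "R m q" using that(2) by (simp add: R_def)
    qed
  qed (use m in \<open>auto simp: A_def\<close>)
qed

text \<open>The Hahn-Banach theorem in the form used below. The norm is first tilted so that its value at \<open>-x\<close> drops to
  \<open>-\<parallel>x\<parallel>\<close>; a minimal functional below the tilted one cannot be tilted any further, in any direction, and is therefore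
  linear.\<close>

lemma real_norming_functional:
  fixes x :: "'x::real_normed_vector"
  obtains u :: "'x \<Rightarrow> real" where "bounded_linear u" "\<And>y. \<bar>u y\<bar> \<le> norm y" "u x = norm x"
proof -
  have N: "norm_dominated_sublinear (norm :: 'x \<Rightarrow> real)"
    by (auto simp: norm_dominated_sublinear_def norm_triangle_ineq)
  obtain q where q: "norm_dominated_sublinear q"
      "\<And>y t. t \<ge> 0 \<Longrightarrow> q y \<le> norm (y + t *\<^sub>R x) - t * norm x"
    using sublinear_tilt[OF N, of x] by metis
  obtain u where u: "norm_dominated_sublinear u" "\<And>y. u y \<le> q y"
    and min: "\<And>r. norm_dominated_sublinear r \<Longrightarrow> (\<And>y. r y \<le> u y) \<Longrightarrow> r = u"
    using minimal_sublinear[OF q(1)] by metis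
  have super: "u y + u z \<le> u (y + z)" for y z
  proof -
    obtain r where r: "norm_dominated_sublinear r" "\<And>y. r y \<le> u y"
        "\<And>y t. t \<ge> 0 \<Longrightarrow> r y \<le> u (y + t *\<^sub>R z) - t * u z"
      using sublinear_tilt[OF u(1), of z] by metis
    have "r = u" using min r by blast
    then show ?thesis using r(3)[of 1 y] by simp
  qed
  have add: "u (y + z) = u y + u z" for y z
    using super[of y z] u(1) by (auto simp: norm_dominated_sublinear_def intro: antisym)
  have u0: "u 0 = 0" by (rule sublinear_zero[OF u(1)])
  have neg: "u (- y) = - u y" for y using add[of y "- y"] u0 by simp
  have le: "\<bar>u y\<bar> \<le> norm y" for y
    using sublinear_lower[OF u(1), of y] u(1) by (auto simp: norm_dominated_sublinear_def abs_le_iff)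
  have hom: "u (r *\<^sub>R y) = r * u y" for r y
  proof -
    have pos: "u (s *\<^sub>R y) = s * u y" if "s > 0" for s
      using u(1) that by (auto simp: norm_dominated_sublinear_def)
    consider "r > 0" | "r = 0" | "- r > 0" by linarith
    then show ?thesis
    proof cases
      case 3 then show ?thesis using pos[OF 3] neg[of "- r *\<^sub>R y"] by simp
    qed (use pos u0 in auto)
  qed
  have "u (- x) \<le> - norm x" using u(2)[of "- x"] q(2)[of 1 "- x"] by simp
  then have "u x = norm x" using le[of x] neg[of x] by simp
  moreover have "bounded_linear u"
    by (rule bounded_linear_intro[of _ 1]) (use add hom le in auto)
  ultimately show thesis using le that by blast
qed

text \<open>The complex functional is \<open>u(x) - i u(i x)\<close>.\<close>

lemma real_functional_complexify:
  fixes u :: "'x::complex_normed_vector \<Rightarrow> real"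
  assumes u: "bounded_linear u"
  obtains \<phi> where "\<phi> \<in> dual" "\<And>x. Re (\<phi> x) = u x"
proof -
  interpret bounded_linear u by fact
  define \<phi> where "\<phi> x = Complex (u x) (- u (\<i> *\<^sub>C x))" for x
  obtain K where K: "\<And>x. \<bar>u x\<bar> \<le> norm x * K" using bounded by auto
  have iR: "a *\<^sub>C (r *\<^sub>R x) = r *\<^sub>R (a *\<^sub>C x)" for r a and x :: 'x
    by (simp add: scaleC_of_real[symmetric] scaleC_scaleC mult.commute)
  have bl: "bounded_linear \<phi>"
  proof (rule bounded_linear_intro[of _ "2 * K"])
    fix x y and r :: real
    show "\<phi> (x + y) = \<phi> x + \<phi> y" by (simp add: \<phi>_def complex_eq_iff add scaleC_add_right)
    show "\<phi> (r *\<^sub>R x) = r *\<^sub>R \<phi> x" by (simp add: \<phi>_def complex_eq_iff scaleR iR)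
    show "norm (\<phi> x) \<le> norm x * (2 * K)"
      using K[of x] K[of "\<i> *\<^sub>C x"] cmod_le[of "\<phi> x"] by (simp add: \<phi>_def norm_scaleC)
  qed
  have "\<phi> (c *\<^sub>C x) = c *\<^sub>C \<phi> x" for c x
  proof -
    have c: "c *\<^sub>C x = Re c *\<^sub>R x + Im c *\<^sub>R (\<i> *\<^sub>C x)"
      unfolding scaleC_of_real[symmetric] scaleC_scaleC scaleC_add_left[symmetric]
      by (metis complex_eq mult.commute)
    have ii: "\<i> *\<^sub>C (\<i> *\<^sub>C x) = - x"
      using scaleC_of_real[of "-1" x] by (simp add: scaleC_scaleC)
    show ?thesis
      unfolding c by (simp add: \<phi>_def complex_eq_iff add scaleR scaleC_add_right iR ii neg
          scaleC_complex_def diff)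
  qed
  then have "\<phi> \<in> dual" using bl by (simp add: dual_def bounded_clinear_def)
  then show thesis by (rule that) (simp add: \<phi>_def)
qed

text \<open>The complexification of a real norming functional has norm at most one: rotating \<open>y\<close> by a unimodular
  factor makes \<open>\<phi>(y)\<close> real, and the real part is bounded by the norm.\<close>

lemma norming_functional:
  fixes x :: "'x::complex_normed_vector"
  obtains \<phi> where "\<phi> \<in> dual" "\<And>y. cmod (\<phi> y) \<le> norm y" "cmod (\<phi> x) = norm x"
proof -
  obtain u :: "'x \<Rightarrow> real" where u: "bounded_linear u" "\<And>y. \<bar>u y\<bar> \<le> norm y" "u x = norm x"
    using real_norming_functional[of x] by metis
  obtain \<phi> where \<phi>: "\<phi> \<in> dual" "\<And>x. Re (\<phi> x) = u x" using real_functional_complexify[OF u(1)] by metis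
  have le: "cmod (\<phi> y) \<le> norm y" for y
  proof (cases "\<phi> y = 0")
    case False
    define c where "c = cnj (\<phi> y) / cmod (\<phi> y)"
    have "cmod c = 1" using False by (simp add: c_def norm_divide)
    have "\<phi> (c *\<^sub>C y) = c * \<phi> y"
      using \<phi>(1) by (simp add: dual_def bounded_clinear_def scaleC_complex_def)
    also have "\<dots> = cmod (\<phi> y)"
      using False complex_norm_square[of "\<phi> y"] by (simp add: c_def field_simps power2_eq_square)
    finally have "cmod (\<phi> y) = u (c *\<^sub>C y)" using \<phi>(2)[of "c *\<^sub>C y"] by simp
    also have "\<dots> \<le> norm y" using u(2)[of "c *\<^sub>C y"] \<open>cmod c = 1\<close> by (simp add: norm_scaleC)
    finally show ?thesis .
  qed simp
  have "norm x \<le> cmod (\<phi> x)" using \<phi>(2)[of x] u(3) complex_Re_le_cmod[of "\<phi> x"] by simp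
  then show thesis using that \<phi>(1) le by (metis antisym)
qed

text \<open>Vectors act by evaluation on the Banach space of bounded real functionals, where the uniform boundedness
  principle applies; norming functionals recover the norm of a vector from its action.\<close>

lemma weakly_bounded_imp_bounded:
  fixes V :: "'x::complex_normed_vector set"
  assumes "\<And>\<phi>. \<phi> \<in> dual \<Longrightarrow> \<exists>B. \<forall>v\<in>V. cmod (\<phi> v) \<le> B"
  shows "\<exists>C\<ge>0. \<forall>v\<in>V. norm v \<le> C"
proof -
  have "\<exists>C\<ge>0. \<forall>v\<in>V. \<forall>u. norm (blinfun_apply u v) \<le> C * norm (u :: 'x \<Rightarrow>\<^sub>L real)"
  proof (rule uniform_boundedness)
    fix u :: "'x \<Rightarrow>\<^sub>L real"
    obtain \<phi> where \<phi>: "\<phi> \<in> dual" "\<And>x. Re (\<phi> x) = u x"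
      using real_functional_complexify[of "blinfun_apply u"] blinfun.bounded_linear_right by metis
    show "\<exists>B. \<forall>v\<in>V. norm (u v) \<le> B"
      using assms[OF \<phi>(1)] abs_Re_le_cmod \<phi>(2) by (metis order_trans real_norm_def)
  qed (rule blinfun.bounded_linear_left)
  then obtain C where C: "C \<ge> 0" "\<And>v u. v \<in> V \<Longrightarrow> norm (blinfun_apply u v) \<le> C * norm (u :: 'x \<Rightarrow>\<^sub>L real)"
    by blast
  have "norm v \<le> C" if "v \<in> V" for v
  proof -
    obtain w :: "'x \<Rightarrow> real" where w: "bounded_linear w" "\<And>y. \<bar>w y\<bar> \<le> norm y" "w v = norm v"
      using real_norming_functional[of v] by metis
    have "norm (Blinfun w) \<le> 1"
      by (rule norm_blinfun_bound) (use w in \<open>auto simp: bounded_linear_Blinfun_apply\<close>)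
    then have "C * norm (Blinfun w) \<le> C" using C(1) by (simp add: mult_left_le)
    then show ?thesis using C(2)[OF that, of "Blinfun w"] w by (simp add: bounded_linear_Blinfun_apply)
  qed
  then show ?thesis using C(1) by blast
qed


section \<open>Strongly continuous semigroups and eigenvectors of the generator\<close>

lemma bounded_bilinear_scaleC:
  "bounded_bilinear (scaleC :: complex \<Rightarrow> 'x \<Rightarrow> 'x::complex_normed_vector)"
proof
  show "\<exists>K. \<forall>a x. norm (a *\<^sub>C (x :: 'x)) \<le> norm a * norm x * K"
    by (rule exI[of _ 1]) (simp add: norm_scaleC)
qed (simp_all add: scaleC_add_left scaleC_add_right scaleC_of_real[symmetric] scaleC_scaleC
    scaleC_complex_def scaleR_conv_of_real mult.commute)

lemmas continuous_on_scaleC [continuous_intros] =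
  bounded_bilinear.continuous_on[OF bounded_bilinear_scaleC]
lemmas tendsto_scaleC [tendsto_intros] =
  bounded_bilinear.tendsto[OF bounded_bilinear_scaleC]
lemmas has_vector_derivative_scaleC =
  bounded_bilinear.has_vector_derivative[OF bounded_bilinear_scaleC]
lemmas scaleC_diff_left = bounded_bilinear.diff_left[OF bounded_bilinear_scaleC]
lemmas scaleC_diff_right = bounded_bilinear.diff_right[OF bounded_bilinear_scaleC]
lemmas scaleC_scaleR_left = bounded_bilinear.scaleR_left[OF bounded_bilinear_scaleC]
lemmas scaleC_scaleR_right = bounded_bilinear.scaleR_right[OF bounded_bilinear_scaleC]

lemma C0_semigroup_D:
  assumes "C0_semigroup T"
  shows "t \<ge> 0 \<Longrightarrow> bounded_linear (T t)" "t \<ge> 0 \<Longrightarrow> T t (c *\<^sub>C x) = c *\<^sub>C T t x"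
    "T 0 x = x" "s \<ge> 0 \<Longrightarrow> t \<ge> 0 \<Longrightarrow> T (s + t) x = T s (T t x)" "continuous_on {0..} (\<lambda>t. T t x)"
  using assms by (auto simp: C0_semigroup_def bounded_clinear_def)

text \<open>Orbits are continuous, hence bounded on \<open>[0,1]\<close>, and uniform boundedness applies.\<close>

lemma C0_semigroup_locally_bounded:
  fixes T :: "real \<Rightarrow> 'a::complex_banach \<Rightarrow> 'a"
  assumes T: "C0_semigroup T"
  obtains M where "M > 0" "\<And>t x. 0 \<le> t \<Longrightarrow> t \<le> 1 \<Longrightarrow> norm (T t x) \<le> M * norm x"
proof -
  have "\<exists>C\<ge>0. \<forall>t\<in>{0..1}. \<forall>x. norm (T t x) \<le> C * norm x"
  proof (rule uniform_boundedness)
    fix x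
    have "continuous_on {0..1} (\<lambda>t. norm (T t x))"
      by (intro continuous_on_norm continuous_on_subset[OF C0_semigroup_D(5)[OF T]]) auto
    then have "bounded ((\<lambda>t. norm (T t x)) ` {0..1})"
      by (intro compact_imp_bounded compact_continuous_image) auto
    then show "\<exists>B. \<forall>t\<in>{0..1}. norm (T t x) \<le> B"
      by (auto simp: bounded_iff)
  qed (use C0_semigroup_D(1)[OF T] in auto)
  then obtain C where C: "C \<ge> 0" "\<And>t x. 0 \<le> t \<Longrightarrow> t \<le> 1 \<Longrightarrow> norm (T t x) \<le> C * norm x"
    by auto
  have "norm (T t x) \<le> (C + 1) * norm x" if "0 \<le> t" "t \<le> 1" for t x
    using C(2)[OF that, of x] by (simp add: algebra_simps add_increasing)
  then show thesis using that[of "C + 1"] C(1) by simp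
qed

text \<open>A visit to a small ball around \<open>u\<close> prolongs to a visit to \<open>U\<close> of length \<open>\<delta>\<close>. This is what allows
  continuous time to be replaced by integer times.\<close>

lemma C0_semigroup_shrink_open:
  fixes T :: "real \<Rightarrow> 'a::complex_banach \<Rightarrow> 'a"
  assumes T: "C0_semigroup T" and U: "open U" "u \<in> U"
  obtains \<delta> \<epsilon> where "0 < \<delta>" "\<delta> \<le> 1" "0 < \<epsilon>"
    "\<And>y s. dist y u < \<epsilon> \<Longrightarrow> 0 \<le> s \<Longrightarrow> s \<le> \<delta> \<Longrightarrow> T s y \<in> U"
proof -
  obtain M where M: "M > 0" "\<And>t x. 0 \<le> t \<Longrightarrow> t \<le> 1 \<Longrightarrow> norm (T t x) \<le> M * norm x"
    using C0_semigroup_locally_bounded[OF T] by metis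
  obtain e where e: "e > 0" "ball u e \<subseteq> U" using U open_contains_ball by blast
  obtain d where d: "d > 0" "\<And>s. 0 \<le> s \<Longrightarrow> s < d \<Longrightarrow> dist (T s u) u < e / 2"
  proof -
    have "e / 2 > 0" using e(1) by simp
    then obtain d where "d > 0" "\<forall>s\<in>{0..}. dist s 0 < d \<longrightarrow> dist (T s u) (T 0 u) < e / 2"
      using C0_semigroup_D(5)[OF T, of u, unfolded continuous_on_iff,
          THEN bspec, of 0, THEN spec, of "e / 2"] by auto
    then show thesis by (intro that[of d]) (auto simp: C0_semigroup_D(3)[OF T])
  qed
  show thesis
  proof
    fix y s assume y: "dist y u < e / (2 * M)" and s: "0 \<le> s" "s \<le> min 1 (d / 2)"
    interpret Ts: bounded_linear "T s" by (rule C0_semigroup_D(1)[OF T s(1)])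
    have "norm (T s (y - u)) \<le> M * norm (y - u)" using M(2) s by simp
    also have "\<dots> < e / 2" using y M(1) by (simp add: dist_norm field_simps)
    finally have "dist (T s y) (T s u) < e / 2" by (simp add: dist_norm Ts.diff)
    moreover have "dist (T s u) u < e / 2" using d s by auto
    ultimately have "dist (T s y) u < e" using dist_triangle[of "T s y" u "T s u"] by linarith
    then show "T s y \<in> U" using e(2) by (auto simp: dist_commute)
  qed (use d(1) e(1) M(1) in auto)
qed

lemma cis_diff_quotient:
  "((\<lambda>h. (cis (l * h) - 1) /\<^sub>R h) \<longlongrightarrow> \<i> * of_real l) (at_right 0)"
proof -
  have "((\<lambda>z. exp (\<i> * of_real l * z)) has_field_derivative \<i> * of_real l) (at 0)"
    by (auto intro!: derivative_eq_intros)
  then have "((\<lambda>z. (exp (\<i> * of_real l * z) - 1) / z) \<longlongrightarrow> \<i> * of_real l) (at 0)"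
    by (simp add: has_field_derivative_iff)
  moreover have "filterlim complex_of_real (at 0) (at_right 0)"
    by (auto simp: filterlim_at eventually_at_filter intro!: tendsto_eq_intros)
  ultimately have "((\<lambda>h. (exp (\<i> * of_real l * complex_of_real h) - 1) / complex_of_real h)
      \<longlongrightarrow> \<i> * of_real l) (at_right 0)"
    by (rule filterlim_compose)
  then show ?thesis
    by (simp add: cis_conv_exp scaleR_conv_of_real divide_inverse ac_simps)
qed

text \<open>In a step of length \<open>h\<close>, the vectors \<open>T\<^sub>h v\<close> and \<open>e\<^sup>i\<^sup>l\<^sup>h v\<close> differ by \<open>o(h)\<close>. With
  \<open>h = 1/n\<close>, the time \<open>1\<close> is reached in \<open>n\<close> steps whose errors add up to \<open>o(1)\<close>.\<close>

lemma generator_eigenvector_orbit: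
  fixes T :: "real \<Rightarrow> 'a::complex_banach \<Rightarrow> 'a"
  assumes T: "C0_semigroup T" and v: "v \<in> generator_domain T"
    and Av: "generator T v = (\<i> * of_real l) *\<^sub>C v"
  shows "T 1 v = cis l *\<^sub>C v"
proof -
  obtain M where M: "M > 0" "\<And>t x. 0 \<le> t \<Longrightarrow> t \<le> 1 \<Longrightarrow> norm (T t x) \<le> M * norm x"
    using C0_semigroup_locally_bounded[OF T] by metis
  define r where "r h = T h v - cis (l * h) *\<^sub>C v" for h
  obtain y where y: "((\<lambda>h. (T h v - v) /\<^sub>R h) \<longlongrightarrow> y) (at_right 0)"
    using v by (auto simp: generator_domain_def)
  then have "generator T v = y" unfolding generator_def by (intro tendsto_Lim) auto
  then have "((\<lambda>h. (T h v - v) /\<^sub>R h - ((cis (l * h) - 1) /\<^sub>R h) *\<^sub>C v) \<longlongrightarrow> 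
      (\<i> * of_real l) *\<^sub>C v - (\<i> * of_real l) *\<^sub>C v) (at_right 0)"
    using y Av by (intro tendsto_intros cis_diff_quotient) auto
  moreover have "(\<lambda>h. (T h v - v) /\<^sub>R h - ((cis (l * h) - 1) /\<^sub>R h) *\<^sub>C v) = (\<lambda>h. r h /\<^sub>R h)"
    by (auto simp: r_def scaleC_scaleR_left scaleC_diff_left scaleR_diff_right)
  ultimately have lim: "((\<lambda>h. r h /\<^sub>R h) \<longlongrightarrow> 0) (at_right 0)" by simp
  \<comment> \<open>The error made in one step of length \<open>h\<close> is transported by the semigroup, whose norm on \<open>[0,1]\<close>
    is at most \<open>M\<close>, and by unimodular factors.\<close>
  have tele: "norm (T (real n * h) v - cis (l * (real n * h)) *\<^sub>C v) \<le> real n * (M * norm (r h))"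
    if "h > 0" "real n * h \<le> 1" for n h
    using that(2)
  proof (induction n)
    case 0 then show ?case by (simp add: C0_semigroup_D[OF T])
  next
    case (Suc n)
    have nh: "real n * h \<le> 1" "0 \<le> real n * h" using Suc.prems that(1) by (auto simp: algebra_simps)
    interpret Tn: bounded_linear "T (real n * h)" by (rule C0_semigroup_D(1)[OF T nh(2)])
    have "T (real (Suc n) * h) v = T (real n * h) (T h v)"
      using C0_semigroup_D(4)[OF T nh(2), of h v] that(1) by (simp add: algebra_simps)
    moreover have "T h v = r h + cis (l * h) *\<^sub>C v" by (simp add: r_def)
    ultimately have "T (real (Suc n) * h) v
        = T (real n * h) (r h) + cis (l * h) *\<^sub>C T (real n * h) v"
      by (simp add: Tn.add C0_semigroup_D(2)[OF T nh(2)])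
    moreover have "cis (l * (real (Suc n) * h)) = cis (l * h) * cis (l * (real n * h))"
      by (simp add: cis_mult algebra_simps)
    ultimately have "T (real (Suc n) * h) v - cis (l * (real (Suc n) * h)) *\<^sub>C v
        = T (real n * h) (r h) + cis (l * h) *\<^sub>C (T (real n * h) v - cis (l * (real n * h)) *\<^sub>C v)"
      by (simp add: scaleC_diff_right scaleC_scaleC)
    also have "norm \<dots> \<le> M * norm (r h) + real n * (M * norm (r h))"
      using M(2)[OF nh(2,1), of "r h"] Suc.IH[OF nh(1)]
      by (intro norm_triangle_mono) (auto simp: norm_scaleC)
    finally show ?case by (simp add: algebra_simps)
  qed
  have "norm (T 1 v - cis l *\<^sub>C v) \<le> M * norm (r (inverse (real (Suc n))) /\<^sub>R inverse (real (Suc n)))" for n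
  proof -
    let ?h = "inverse (real (Suc n))"
    have "real (Suc n) * ?h = 1" by (simp add: field_simps)
    then have "norm (T 1 v - cis l *\<^sub>C v) \<le> real (Suc n) * (M * norm (r ?h))"
      using tele[of ?h "Suc n"] by simp
    also have "\<dots> = M * norm (r ?h /\<^sub>R ?h)" by simp
    finally show ?thesis .
  qed
  moreover have "(\<lambda>n. M * norm (r (inverse (real (Suc n))) /\<^sub>R inverse (real (Suc n)))) \<longlonglongrightarrow> M * norm (0::'a)"
  proof (intro tendsto_intros filterlim_compose[OF lim])
    show "filterlim (\<lambda>n. inverse (real (Suc n))) (at_right 0) sequentially"
      using LIMSEQ_inverse_real_of_nat by (auto simp: filterlim_at)
  qed
  ultimately have "norm (T 1 v - cis l *\<^sub>C v) \<le> M * norm (0::'a)"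
    by (intro tendsto_lowerbound[where F = sequentially]) auto
  then show ?thesis by simp
qed


section \<open>Separated sets of integers with linear growth\<close>

text \<open>The Cauchy criterion for unconditional convergence of a series over an arbitrary index set.\<close>

definition unconditionally_cauchy :: "('i \<Rightarrow> 'x::real_normed_vector) \<Rightarrow> bool"
  where "unconditionally_cauchy x \<longleftrightarrow>
    (\<forall>e>0. \<exists>G. finite G \<and> (\<forall>F. finite F \<and> F \<inter> G = {} \<longrightarrow> norm (sum x F) < e))"

lemma sum_multiples_indicator:
  fixes c :: nat
  shows "(\<Sum>i=1..k. if d dvd i then c else 0) = c * (k div d)"
  by (induction k) (auto simp: div_Suc mod_eq_0_iff_dvd)

text \<open>Natural numbers \<open>i\<close> are placed on the line at points \<open>p(i)\<close>, and \<open>A\<^sub>j\<close> consists of the points whose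
  index is an odd multiple of \<open>d\<^sub>j = 4 ^ N\<^sub>j\<close>. Around \<open>p(i)\<close> a space of
  \<open>w(i)\<close> is kept free, where \<open>w(i)\<close> is the sum of all \<open>N\<^sub>j\<close> with \<open>d\<^sub>j\<close> dividing \<open>i\<close>. The distance \<open>N\<^sub>j\<close> is
  thus required only at every \<open>4 ^ N\<^sub>j\<close>-th index, and \<open>\<Sum>\<^sub>j N\<^sub>j / 4 ^ N\<^sub>j\<close> converges; so \<open>p\<close> grows
  linearly, and each \<open>A\<^sub>j\<close> has positive lower density.\<close>

lemma separated_linear_sets:
  fixes N :: "nat \<Rightarrow> nat"
  assumes N: "strict_mono N" "0 < N 0"
  obtains A :: "nat \<Rightarrow> nat set" where
    "\<And>j n. n \<in> A j \<Longrightarrow> N j \<le> n"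
    "\<And>j k n m. n \<in> A j \<Longrightarrow> m \<in> A k \<Longrightarrow> n < m \<Longrightarrow> n + N j + N k \<le> m"
    "\<And>j k. j \<noteq> k \<Longrightarrow> A j \<inter> A k = {}"
    "\<And>j. \<exists>a K. strict_mono a \<and> range a \<subseteq> A j \<and> (\<forall>r. a r \<le> K * Suc r)"
proof -
  have N_ge: "j \<le> N j" and N_pos: "0 < N j" for j
    using N strict_mono_imp_increasing[OF N(1)] strict_mono_less_eq[OF N(1), of 0 j] by auto
  define d :: "nat \<Rightarrow> nat" where "d j = 2 ^ (2 * N j)" for j
  define w where "w i = (\<Sum>j<i. if d j dvd i then N j else 0)" for i
  define p where "p k = 2 * (\<Sum>i<k. w i) + w k" for k
  \<comment> \<open>Cutting the sum in \<open>w i\<close> at \<open>j < i\<close> loses no divisor, since \<open>j < d j\<close>.\<close>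
  have w_ge: "N j \<le> w i" if "d j dvd i" "i > 0" for i j
  proof -
    have "j \<le> 2 * N j" using N_ge[of j] by simp
    also have "\<dots> < d j" unfolding d_def by (rule less_exp)
    also have "\<dots> \<le> i" using that by (rule dvd_imp_le)
    finally have "(\<Sum>j'\<in>{j}. if d j' dvd i then N j' else 0) \<le> w i"
      unfolding w_def by (intro sum_mono2) auto
    then show ?thesis using that by simp
  qed
  have gap: "p k + w k + w k' \<le> p k'" if "k < k'" for k k'
  proof -
    have "(\<Sum>i<Suc k. w i) \<le> (\<Sum>i<k'. w i)" using that by (intro sum_mono2) auto
    then show ?thesis by (simp add: p_def)
  qed
  have p_mono: "k < k'" if "p k < p k'" for k k'
    using gap[of k' k] that by (cases k k' rule: linorder_cases) auto
  have p_le: "p k \<le> 4 * k" for k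
  proof -
    have "p k \<le> 2 * (\<Sum>i=1..k. w i)"
    proof -
      have "w 0 = 0" by (simp add: w_def)
      then have "(\<Sum>i=1..k. w i) = (\<Sum>i<Suc k. w i)"
        by (intro sum.mono_neutral_left) (auto simp: not_less_eq_eq)
      then show ?thesis by (simp add: p_def)
    qed
    also have "\<dots> \<le> 2 * (\<Sum>i=1..k. \<Sum>j<k. if d j dvd i then N j else 0)"
      unfolding w_def by (intro mult_left_mono sum_mono sum_mono2) auto
    also have "\<dots> = 2 * (\<Sum>j<k. N j * (k div d j))"
      by (subst sum.swap) (simp only: sum_multiples_indicator)
    finally have "real (p k) \<le> real (2 * (\<Sum>j<k. N j * (k div d j)))"
      by (rule of_nat_mono)
    also have "\<dots> = 2 * (\<Sum>j<k. real (N j * (k div d j)))" by simp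
    finally have real_p: "real (p k) \<le> 2 * (\<Sum>j<k. real (N j * (k div d j)))" .
    have "(\<Sum>j<k. real (N j * (k div d j))) \<le> (\<Sum>j<k. real k * (1 / 2) ^ j)"
    proof (rule sum_mono)
      fix j
      have dj: "real (d j) = 2 ^ N j * 2 ^ N j" by (simp add: d_def mult_2 power_add)
      have "real (N j * (k div d j)) \<le> 2 ^ N j * (real k / real (d j))"
        unfolding of_nat_mult
        by (intro mult_mono of_nat_div_le_of_nat) (use less_exp[of "N j"] in \<open>auto simp: less_imp_le\<close>)
      also have "\<dots> = real k * (1 / 2) ^ N j"
        by (simp add: dj power_one_over field_simps)
      also have "\<dots> \<le> real k * (1 / 2) ^ j"
        by (intro mult_left_mono power_decreasing N_ge) auto
      finally show "real (N j * (k div d j)) \<le> real k * (1 / 2) ^ j" .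
    qed
    also have "\<dots> \<le> real k * 2"
      unfolding sum_distrib_left[symmetric]
      by (intro mult_left_mono) (auto simp: geometric_sum)
    finally show ?thesis using real_p by linarith
  qed
  define A where "A j = (\<lambda>r. p (d j * (2 * r + 1))) ` UNIV" for j
  have idx: "j = k" if "d j * (2 * r + 1) = d k * (2 * s + 1)" for j k r s :: nat
  proof -
    have *: False if "d j * (2 * r + 1) = d k * (2 * s + 1)" "j < k" for j k r s
    proof -
      have "N j < N k" using that(2) N(1) by (simp add: strict_mono_less)
      then have "d k = d j * (2 * 2 ^ (2 * N k - 2 * N j - 1))"
        unfolding d_def power_Suc[symmetric] power_add[symmetric]
        by (intro arg_cong[of _ _ "(^) 2"]) simp
      moreover have "d j > 0" by (simp add: d_def)
      ultimately have "2 * r + 1 = 2 * 2 ^ (2 * N k - 2 * N j - 1) * (2 * s + 1)"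
        using that(1) by (simp only: mult.assoc mult_left_cancel)
      then have "2 * r + 1 = 2 * (2 ^ (2 * N k - 2 * N j - 1) * (2 * s + 1))"
        by (simp only: mult.assoc)
      then show False by presburger
    qed
    from *[of j r k s] *[of k s j r] that show ?thesis by (cases j k rule: linorder_cases) auto
  qed
  have wA: "N j \<le> w (d j * (2 * r + 1))" for j r by (rule w_ge) (auto simp: d_def)
  show thesis
  proof
    show "N j \<le> n" if "n \<in> A j" for j n
      using that wA[of j] by (auto simp: A_def p_def intro!: trans_le_add2)
    show sep: "n + N j + N k \<le> m" if nA: "n \<in> A j" and mA: "m \<in> A k" and nm: "n < m" for j k n m
    proof -
      obtain r s where rs: "n = p (d j * (2 * r + 1))" "m = p (d k * (2 * s + 1))"
        using nA mA unfolding A_def by blast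
      have "d j * (2 * r + 1) < d k * (2 * s + 1)" using nm unfolding rs by (rule p_mono)
      from gap[OF this] show ?thesis using wA[of j r] wA[of k s] unfolding rs by linarith
    qed
    show "A j \<inter> A k = {}" if "j \<noteq> k" for j k
    proof -
      have "p (d j * (2 * r + 1)) \<noteq> p (d k * (2 * s + 1))" for r s
        using idx[of j r k s] that gap[of "d j * (2 * r + 1)" "d k * (2 * s + 1)"] N_pos[of j]
          gap[of "d k * (2 * s + 1)" "d j * (2 * r + 1)"] wA[of j r]
        by (cases "d j * (2 * r + 1)" "d k * (2 * s + 1)" rule: linorder_cases) linarith+
      then show ?thesis by (auto simp: A_def)
    qed
    show "\<exists>a K. strict_mono a \<and> range a \<subseteq> A j \<and> (\<forall>r. a r \<le> K * Suc r)" for j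
    proof (intro exI conjI allI)
      let ?a = "\<lambda>r. p (d j * (2 * r + 1))"
      show "strict_mono ?a"
      proof (rule strict_monoI)
        fix r s :: nat assume "r < s"
        then have "d j * (2 * r + 1) < d j * (2 * s + 1)" by (simp add: d_def)
        from gap[OF this] show "?a r < ?a s" using wA[of j r] N_pos[of j] by linarith
      qed
      show "range ?a \<subseteq> A j" by (simp add: A_def)
      show "?a r \<le> 8 * d j * Suc r" for r
        by (rule order_trans[OF p_le]) (simp add: algebra_simps)
    qed
  qed
qed


section \<open>A vector whose orbit approximates a sequence of vectors\<close>

text \<open>The vector is \<open>x = \<Sum>\<^sub>j \<Sum>\<^sub>n\<^sub>\<in>\<^sub>A\<^sub>j \<psi>\<^sub>j(-n)\<close>. For \<open>m \<in> A\<^sub>l\<close>, the summand \<open>n = m\<close> of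
  \<open>S\<^sup>m x = \<Sum>\<^sub>j \<Sum>\<^sub>n\<^sub>\<in>\<^sub>A\<^sub>j \<psi>\<^sub>j(m - n)\<close> is \<open>\<psi>\<^sub>l(0)\<close>. In every other summand, \<open>|m - n|\<close> is at
  least \<open>N\<close> at the larger of \<open>j\<close> and \<open>l\<close>, so that the \<open>j\<close>-th inner sum is smaller than
  \<open>(1/4) ^ max j l \<le> (1/2) ^ j * (1/2) ^ l\<close>. Only finite sums are estimated; \<open>x\<close> is the limit of partial sums.\<close>

lemma orbit_approximating_sequence:
  fixes S :: "'x::banach \<Rightarrow> 'x" and \<psi> :: "nat \<Rightarrow> int \<Rightarrow> 'x"
  assumes S: "bounded_linear S" and step: "\<And>j n. S (\<psi> j n) = \<psi> j (n + 1)"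
    and unc: "\<And>j. unconditionally_cauchy (\<psi> j)"
  obtains x where "\<And>l. \<exists>a K. strict_mono a \<and> (\<forall>r. a r \<le> K * Suc r) \<and>
    (\<forall>r. norm ((S ^^ a r) x - \<psi> l 0) \<le> 2 * (1 / 2) ^ l)"
proof -
  have tail: "\<exists>M. \<forall>F. finite F \<and> (\<forall>n\<in>F. int M \<le> \<bar>n\<bar>) \<longrightarrow> norm (sum (\<psi> j) F) < e"
    if "e > 0" for j e
  proof -
    have "\<exists>G. finite G \<and> (\<forall>F. finite F \<and> F \<inter> G = {} \<longrightarrow> norm (sum (\<psi> j) F) < e)"
      using unc[of j] that by (simp add: unconditionally_cauchy_def)
    then obtain G where G: "finite G" "\<And>F. finite F \<Longrightarrow> F \<inter> G = {} \<Longrightarrow> norm (sum (\<psi> j) F) < e"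
      by auto
    obtain b where b: "\<And>n. n \<in> G \<Longrightarrow> \<bar>n\<bar> \<le> b"
    proof -
      have "\<bar>n\<bar> \<le> Max (abs ` G)" if "n \<in> G" for n
        by (rule Max_ge) (use G(1) that in auto)
      then show thesis by (rule that)
    qed
    show ?thesis
    proof (intro exI[of _ "nat (b + 1)"] allI impI G(2))
      fix F :: "int set" assume "finite F \<and> (\<forall>n\<in>F. int (nat (b + 1)) \<le> \<bar>n\<bar>)"
      then have "n \<notin> G" if "n \<in> F" for n using that b[of n] by auto
      then show "F \<inter> G = {}" by auto
    qed auto
  qed
  have "\<exists>M. \<forall>j\<le>l. \<forall>F. finite F \<and> (\<forall>n\<in>F. int M \<le> \<bar>n\<bar>) \<longrightarrow> norm (sum (\<psi> j) F) < (1 / 4) ^ l" for l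
  proof -
    have "\<forall>j. \<exists>M. \<forall>F. finite F \<and> (\<forall>n\<in>F. int M \<le> \<bar>n\<bar>) \<longrightarrow> norm (sum (\<psi> j) F) < (1 / 4) ^ l"
      by (intro allI tail) simp
    from choice[OF this] obtain m where m: "\<forall>j F. finite F \<and> (\<forall>n\<in>F. int (m j) \<le> \<bar>n\<bar>) \<longrightarrow>
        norm (sum (\<psi> j) F) < (1 / 4) ^ l" ..
    show ?thesis
    proof (intro exI[of _ "\<Sum>j\<le>l. m j"] allI impI)
      fix j F assume j: "j \<le> l" and F: "finite F \<and> (\<forall>n\<in>F. int (\<Sum>j\<le>l. m j) \<le> \<bar>n\<bar>)"
      have "m j \<le> (\<Sum>j\<le>l. m j)" using j by (intro member_le_sum) auto
      then have mj: "int (m j) \<le> int (\<Sum>j\<le>l. m j)" by (rule of_nat_mono)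
      have "int (m j) \<le> \<bar>n\<bar>" if "n \<in> F" for n using F that by (blast intro: order_trans[OF mj])
      then show "norm (sum (\<psi> j) F) < (1 / 4) ^ l" using m F by blast
    qed
  qed
  then have "\<forall>l. \<exists>M. \<forall>j\<le>l. \<forall>F. finite F \<and> (\<forall>n\<in>F. int M \<le> \<bar>n\<bar>) \<longrightarrow>
      norm (sum (\<psi> j) F) < (1 / 4) ^ l" by blast
  from choice[OF this] obtain M where M': "\<forall>l. \<forall>j\<le>l. \<forall>F. finite F \<and> (\<forall>n\<in>F. int (M l) \<le> \<bar>n\<bar>) \<longrightarrow>
      norm (sum (\<psi> j) F) < (1 / 4) ^ l" ..
  have M: "norm (sum (\<psi> j) F) < (1 / 4) ^ l"
    if "j \<le> l" "finite F" "\<And>n. n \<in> F \<Longrightarrow> int (M l) \<le> \<bar>n\<bar>" for l j F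
    using M' that by blast
  define N where "N l = (\<Sum>i\<le>l. M i + 1)" for l
  have "strict_mono N" by (rule strict_monoI_Suc) (simp add: N_def)
  have N_M: "M l \<le> N l" for l by (cases l) (simp_all add: N_def)
  have "0 < N 0" by (simp add: N_def)
  obtain A where A_ge: "\<And>j n. n \<in> A j \<Longrightarrow> N j \<le> n"
    and A_sep: "\<And>j k n m. n \<in> A j \<Longrightarrow> m \<in> A k \<Longrightarrow> n < m \<Longrightarrow> n + N j + N k \<le> m"
    and A_disj: "\<And>j k. j \<noteq> k \<Longrightarrow> A j \<inter> A k = {}"
    and A_dens: "\<And>j. \<exists>a K. strict_mono a \<and> range a \<subseteq> A j \<and> (\<forall>r. a r \<le> K * Suc r)"
    using separated_linear_sets[OF \<open>strict_mono N\<close> \<open>0 < N 0\<close>] by metis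
  define D where "D = (\<Union>j. A j)"
  define lab where "lab n = (SOME j. n \<in> A j)" for n
  have lab: "n \<in> A (lab n)" if "n \<in> D" for n
    using that unfolding D_def lab_def by (metis UN_E someI_ex)
  have lab_eq: "lab n = j" if "n \<in> A j" for n j
    using that lab[of n] A_disj[of "lab n" j] by (auto simp: D_def)
  define z where "z m n = \<psi> (lab n) (int m - int n)" for m n
  have iter: "(S ^^ m) (z 0 n) = z m n" for m n
    by (induction m) (auto simp: z_def step algebra_simps)
  have Sm: "bounded_linear (S ^^ m)" for m
  proof (induction m)
    case 0 then show ?case by (simp add: id_def)
  next
    case (Suc m) then show ?case using bounded_linear_compose[OF S Suc] by (simp add: o_def)
  qed
  \<comment> \<open>This estimate serves twice: with \<open>m = 0\<close> for the convergence of the partial sums, and with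
    \<open>m \<in> A l\<close> for the distance of the orbit from \<open>\<psi> l 0\<close>.\<close>
  have group: "norm (\<Sum>n\<in>F. z m n) \<le> 2 * (1 / 2) ^ l"
    if F: "finite F" "F \<subseteq> D"
      and far: "\<And>n. n \<in> F \<Longrightarrow> int (N (lab n)) \<le> \<bar>int m - int n\<bar> \<and> int (N l) \<le> \<bar>int m - int n\<bar>"
    for F m l
  proof -
    have inner: "norm (\<Sum>n\<in>{n\<in>F. lab n = j}. z m n) \<le> (1 / 2) ^ l * (1 / 2) ^ j" for j
    proof -
      let ?F = "{n\<in>F. lab n = j}" and ?g = "\<lambda>n. int m - int n"
      have "(\<Sum>n\<in>?F. z m n) = (\<Sum>n\<in>?F. \<psi> j (?g n))" by (simp add: z_def)
      also have "\<dots> = sum (\<psi> j) (?g ` ?F)"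
        by (subst sum.reindex) (auto simp: inj_on_def)
      also have "norm \<dots> < (1 / 4) ^ max j l"
      proof (rule M)
        fix i assume "i \<in> ?g ` ?F"
        then have "int (N (max j l)) \<le> \<bar>i\<bar>" using far by (auto simp: max_def)
        then show "int (M (max j l)) \<le> \<bar>i\<bar>" using N_M[of "max j l"] by linarith
      qed (use F in auto)
      also have "(1 / 4 :: real) ^ max j l = (1 / 2) ^ max j l * (1 / 2) ^ max j l"
        by (simp flip: power_mult_distrib)
      also have "\<dots> \<le> (1 / 2) ^ l * (1 / 2) ^ j"
        by (intro mult_mono power_decreasing) auto
      finally show ?thesis by simp
    qed
    define J where "J = Suc (Max (insert 0 (lab ` F)))"
    have J: "lab n < J" if "n \<in> F" for n using F(1) that by (simp add: J_def less_Suc_eq_le)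
    have "(\<Sum>n\<in>F. z m n) = (\<Sum>j<J. \<Sum>n\<in>{n\<in>F. lab n = j}. z m n)"
      using F(1) J by (intro sum.group[symmetric]) auto
    also have "norm \<dots> \<le> (\<Sum>j<J. (1 / 2) ^ l * (1 / 2) ^ j)"
      by (rule sum_norm_le) (rule inner)
    also have "\<dots> \<le> (1 / 2) ^ l * 2"
      unfolding sum_distrib_left[symmetric] by (intro mult_left_mono) (auto simp: geometric_sum)
    finally show ?thesis by simp
  qed
  define X where "X K = (\<Sum>n\<in>D \<inter> {..<K}. z 0 n)" for K
  have "Cauchy X"
  proof (rule CauchyI)
    fix e :: real assume e: "e > 0"
    obtain l where l: "(1 / 2 :: real) ^ l < e / 2"
      using e real_arch_pow_inv[of "e / 2" "1 / 2"] by auto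
    have *: "norm (X K' - X K) < e" if "N l \<le> K" "K \<le> K'" for K K'
    proof -
      have "X K' - X K = sum (z 0) (D \<inter> {K..<K'})"
        using that unfolding X_def
        by (subst sum_diff[symmetric]) (auto intro!: sum.cong)
      also have "norm \<dots> \<le> 2 * (1 / 2) ^ l"
        using that A_ge[OF lab] by (intro group) auto
      finally show ?thesis using l by simp
    qed
    show "\<exists>K0. \<forall>K\<ge>K0. \<forall>K'\<ge>K0. norm (X K - X K') < e"
    proof (intro exI[of _ "N l"] allI impI)
      fix K K' assume "N l \<le> K" "N l \<le> K'"
      then show "norm (X K - X K') < e"
        using *[of K K'] *[of K' K] by (cases "K \<le> K'") (auto simp: norm_minus_commute)
    qed
  qed
  then obtain x where x: "X \<longlonglongrightarrow> x" using Cauchy_convergent convergent_def by blast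
  have near: "norm ((S ^^ m) x - \<psi> l 0) \<le> 2 * (1 / 2) ^ l" if m: "m \<in> A l" for m l
  proof -
    interpret Sm: bounded_linear "S ^^ m" by (rule Sm)
    have "(\<lambda>K. norm ((S ^^ m) (X K) - \<psi> l 0)) \<longlonglongrightarrow> norm ((S ^^ m) x - \<psi> l 0)"
      by (intro tendsto_intros Sm.tendsto x)
    moreover have "norm ((S ^^ m) (X K) - \<psi> l 0) \<le> 2 * (1 / 2) ^ l" if K: "m < K" for K
    proof -
      have "(S ^^ m) (X K) = (\<Sum>n\<in>D \<inter> {..<K}. z m n)" by (simp add: X_def Sm.sum iter)
      also have "\<dots> = z m m + (\<Sum>n\<in>D \<inter> {..<K} - {m}. z m n)"
        using K m by (intro sum.remove) (auto simp: D_def)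
      also have "z m m = \<psi> l 0" using lab_eq[OF m] by (simp add: z_def)
      finally have "(S ^^ m) (X K) - \<psi> l 0 = (\<Sum>n\<in>D \<inter> {..<K} - {m}. z m n)" by simp
      also have "norm \<dots> \<le> 2 * (1 / 2) ^ l"
      proof (rule group)
        fix n assume "n \<in> D \<inter> {..<K} - {m}"
        then have n: "n \<in> A (lab n)" "n \<noteq> m" using lab by auto
        show "int (N (lab n)) \<le> \<bar>int m - int n\<bar> \<and> int (N l) \<le> \<bar>int m - int n\<bar>"
          using A_sep[OF n(1) m] A_sep[OF m n(1)] n(2) by linarith
      qed auto
      finally show ?thesis .
    qed
    ultimately show ?thesis
      by (intro tendsto_upperbound[where F = sequentially])
         (auto simp: eventually_sequentially intro!: exI[of _ "Suc m"])
  qed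
  show thesis
  proof (rule that[of x])
    fix l
    obtain a K where "strict_mono a" "range a \<subseteq> A l" "\<forall>r. a r \<le> K * Suc r"
      using A_dens[of l] by metis
    then show "\<exists>a K. strict_mono a \<and> (\<forall>r. a r \<le> K * Suc r) \<and>
        (\<forall>r. norm ((S ^^ a r) x - \<psi> l 0) \<le> 2 * (1 / 2) ^ l)"
      by (intro exI[of _ a] exI[of _ K] conjI allI near) auto
  qed
qed

text \<open>The intervals are disjoint because \<open>\<delta> \<le> 1\<close>, and at least about \<open>x / K\<close> of them lie in \<open>[0,x]\<close>.\<close>

lemma lower_density_pos:
  fixes a :: "nat \<Rightarrow> nat"
  assumes M: "M \<in> sets lebesgue" and a: "strict_mono a" "\<And>r. a r \<le> K * Suc r"
    and \<delta>: "0 < \<delta>" "\<delta> \<le> 1" and sub: "\<And>r. {real (a r)..real (a r) + \<delta>} \<subseteq> M"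
  shows "lower_density M > 0"
proof -
  have K: "K > 0" using a(2)[of 1] strict_monoD[OF a(1), of 0 1] by (cases K) auto
  have "\<delta> / (2 * real K) \<le> measure lebesgue (M \<inter> {0..x}) / x" if x: "x \<ge> 2 + 2 * real K" for x
  proof -
    define R where "R = nat \<lfloor>(x - 1) / K\<rfloor>"
    have R: "real R \<le> (x - 1) / K" "(x - 1) / K - 1 \<le> real R"
    proof -
      have "0 \<le> (x - 1) / K" using x K by simp
      then show "real R \<le> (x - 1) / K" "(x - 1) / K - 1 \<le> real R"
        unfolding R_def by linarith+
    qed
    define U where "U = (\<Union>r<R. {real (a r)..<real (a r) + \<delta>})"
    have sep: "real (a r) + 1 \<le> real (a s)" if "r < s" for r s
      using strict_monoD[OF a(1) that] by linarith
    have "disjoint_family_on (\<lambda>r. {real (a r)..<real (a r) + \<delta>}) {..<R}"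
      unfolding disjoint_family_on_def
    proof (intro ballI impI)
      fix r s :: nat assume "r \<noteq> s"
      then show "{real (a r)..<real (a r) + \<delta>} \<inter> {real (a s)..<real (a s) + \<delta>} = {}"
        using sep[of r s] sep[of s r] \<delta>(2) by (cases r s rule: linorder_cases) auto
    qed
    then have "measure lebesgue U = (\<Sum>r<R. measure lebesgue {real (a r)..<real (a r) + \<delta>})"
      unfolding U_def by (intro measure_finite_Union) (use \<delta> in auto)
    also have "\<dots> = real R * \<delta>" using \<delta> by simp
    finally have U: "measure lebesgue U = real R * \<delta>" .
    have "U \<subseteq> M \<inter> {0..x}"
    proof
      fix t assume "t \<in> U"
      then obtain r where r: "r < R" "real (a r) \<le> t" "t < real (a r) + \<delta>" by (auto simp: U_def)
      have "real (a r) \<le> real (K * Suc r)" using a(2)[of r] by (rule of_nat_mono)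
      also have "\<dots> \<le> real (K * R)" using r(1) by (intro of_nat_mono mult_le_mono2) simp
      also have "\<dots> = real K * real R" by simp
      also have "\<dots> \<le> x - 1" using R(1) K by (simp add: field_simps)
      finally have "t \<le> x" using r \<delta> by linarith
      then show "t \<in> M \<inter> {0..x}" using r sub[of r] by auto
    qed
    then have "measure lebesgue U \<le> measure lebesgue (M \<inter> {0..x})"
      using M fmeasurable_Int_fmeasurable[of "{0..x}" lebesgue M]
      by (intro measure_mono_fmeasurable) (auto simp: U_def Int_commute)
    then have "((x - 1) / K - 1) * \<delta> \<le> measure lebesgue (M \<inter> {0..x})"
      using U R(2) \<delta>(1) by (smt (verit) mult_right_mono)
    moreover have "x * \<delta> / (2 * K) \<le> ((x - 1) / K - 1) * \<delta>"
    proof -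
      have "x / (2 * K) \<le> (x - 1) / K - 1" using x K by (simp add: field_simps)
      then have "x / (2 * K) * \<delta> \<le> ((x - 1) / K - 1) * \<delta>" using \<delta>(1) by (intro mult_right_mono) auto
      then show ?thesis by simp
    qed
    ultimately have "x * \<delta> / (2 * K) \<le> measure lebesgue (M \<inter> {0..x})" by linarith
    then show ?thesis using x K by (simp add: field_simps)
  qed
  then have "ereal (\<delta> / (2 * real K)) \<le> lower_density M"
    unfolding lower_density_def
    by (intro Liminf_bounded) (auto simp: eventually_at_top_linorder intro!: exI[of _ "2 + 2 * real K"])
  moreover have "0 < ereal (\<delta> / (2 * real K))" using \<delta> K by simp
  ultimately show ?thesis by (rule less_le_trans[rotated])
qed


section \<open>Unconditional series in spaces without c0\<close>

text \<open>Rosenthal's lemma, by induction on a bound \<open>n \<epsilon>\<close> for the off-diagonal row sums. The indices are partitioned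
  into infinitely many infinite classes. Either one class already has small off-diagonal row sums, or each class
  contains a row whose sum over the rest of its class exceeds \<open>\<epsilon>\<close>. Choosing one such row from each class gives an
  infinite submatrix that has lost these entries, so its off-diagonal row sums are at most \<open>(n - 1) \<epsilon>\<close>.\<close>

lemma rosenthal_matrix:
  fixes a :: "nat \<Rightarrow> nat \<Rightarrow> real"
  assumes nonneg: "\<And>k m. 0 \<le> a k m" and rows: "\<And>k F. finite F \<Longrightarrow> sum (a k) F \<le> C"
    and \<epsilon>: "\<epsilon> > 0"
  obtains s :: "nat \<Rightarrow> nat" where "inj s"
    "\<And>k F. finite F \<Longrightarrow> k \<notin> F \<Longrightarrow> (\<Sum>m\<in>F. a (s k) (s m)) \<le> \<epsilon>"
proof -
  have main: "\<exists>s :: nat \<Rightarrow> nat. inj s \<and> (\<forall>k F. finite F \<and> k \<notin> F \<longrightarrow> (\<Sum>m\<in>F. a (s k) (s m)) \<le> \<epsilon>)"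
    if "\<And>k m. 0 \<le> a k m" "\<And>k F. finite F \<Longrightarrow> k \<notin> F \<Longrightarrow> sum (a k) F \<le> real n * \<epsilon>"
    for n and a :: "nat \<Rightarrow> nat \<Rightarrow> real"
    using that
  proof (induction n arbitrary: a)
    case 0
    have *: "(\<Sum>m\<in>F. a k m) \<le> \<epsilon>" if "finite F" "k \<notin> F" for k F
      using 0(2)[of F k] that \<epsilon> by simp
    show ?case by (rule exI[of _ id]) (simp add: *)
  next
    case (Suc n)
    define e :: "nat \<Rightarrow> nat \<Rightarrow> nat" where "e p q = prod_encode (p, q)" for p q
    have e_eq: "e p q = e p' q' \<longleftrightarrow> p = p' \<and> q = q'" for p q p' q' by (simp add: e_def)
    show ?case
    proof (cases "\<exists>p. \<forall>k F. finite F \<and> k \<notin> F \<longrightarrow> (\<Sum>m\<in>F. a (e p k) (e p m)) \<le> \<epsilon>")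
      case True
      then obtain p where p: "\<forall>k F. finite F \<and> k \<notin> F \<longrightarrow> (\<Sum>m\<in>F. a (e p k) (e p m)) \<le> \<epsilon>" ..
      moreover have "inj (e p)" by (simp add: inj_on_def e_eq)
      ultimately show ?thesis by (intro exI[of _ "e p"]) simp
    next
      case False
      then have "\<forall>p. \<exists>kF. finite (snd kF) \<and> fst kF \<notin> snd kF \<and> \<epsilon> < (\<Sum>m\<in>snd kF. a (e p (fst kF)) (e p m))"
        by (simp add: not_le)
      from choice[OF this] obtain kF where kF: "\<forall>p. finite (snd (kF p)) \<and> fst (kF p) \<notin> snd (kF p) \<and>
          \<epsilon> < (\<Sum>m\<in>snd (kF p). a (e p (fst (kF p))) (e p m))" ..
      define k where "k p = fst (kF p)" for p
      define F where "F p = snd (kF p)" for p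
      have F: "finite (F p)" "k p \<notin> F p" "\<epsilon> < (\<Sum>m\<in>F p. a (e p (k p)) (e p m))" for p
        using kF by (auto simp: k_def F_def)
      define t where "t p = e p (k p)" for p
      have t_inj: "inj t" by (auto simp: inj_on_def t_def e_eq)
      have off: "(\<Sum>q\<in>H. a (t p) (t q)) \<le> real n * \<epsilon>" if H: "finite H" "p \<notin> H" for p H
      proof -
        have "sum (a (t p)) (t ` H \<union> e p ` F p) \<le> real (Suc n) * \<epsilon>"
          using H F by (intro Suc.prems(2)) (auto simp: t_def e_eq)
        moreover have "sum (a (t p)) (t ` H \<union> e p ` F p) = sum (a (t p)) (t ` H) + sum (a (t p)) (e p ` F p)"
          using H F by (intro sum.union_disjoint) (auto simp: t_def e_eq)
        moreover have "sum (a (t p)) (t ` H) = (\<Sum>q\<in>H. a (t p) (t q))"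
          using inj_on_subset[OF t_inj] by (simp add: sum.reindex)
        moreover have "sum (a (t p)) (e p ` F p) = (\<Sum>m\<in>F p. a (t p) (e p m))"
          by (subst sum.reindex) (auto simp: inj_on_def e_eq)
        ultimately show ?thesis using F(3)[of p] by (simp add: t_def algebra_simps)
      qed
      have "\<exists>s :: nat \<Rightarrow> nat. inj s \<and> (\<forall>k F. finite F \<and> k \<notin> F \<longrightarrow> (\<Sum>m\<in>F. a (t (s k)) (t (s m))) \<le> \<epsilon>)"
        by (rule Suc.IH) (use Suc.prems(1) off in auto)
      then obtain s :: "nat \<Rightarrow> nat" where s: "inj s \<and> (\<forall>k F. finite F \<and> k \<notin> F \<longrightarrow> (\<Sum>m\<in>F. a (t (s k)) (t (s m))) \<le> \<epsilon>)" ..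
      then show ?thesis using inj_compose[OF t_inj, of s] by (intro exI[of _ "t \<circ> s"]) (simp add: o_def)
    qed
  qed
  obtain n where n: "C \<le> real n * \<epsilon>" using reals_Archimedean3[OF \<epsilon>] less_imp_le by blast
  have "\<exists>s :: nat \<Rightarrow> nat. inj s \<and> (\<forall>k F. finite F \<and> k \<notin> F \<longrightarrow> (\<Sum>m\<in>F. a (s k) (s m)) \<le> \<epsilon>)"
    by (rule main[of a n]) (simp_all add: nonneg order_trans[OF rows n])
  then obtain s :: "nat \<Rightarrow> nat" where "inj s \<and> (\<forall>k F. finite F \<and> k \<notin> F \<longrightarrow> (\<Sum>m\<in>F. a (s k) (s m)) \<le> \<epsilon>)" ..
  then show thesis by (intro that[of s]) simp_all
qed

lemma apply_bcontfun_add: "apply_bcontfun (x + y) n = apply_bcontfun x n + apply_bcontfun y n"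
  by (simp add: plus_bcontfun.rep_eq)

lemma Cauchy_bcontfun_convergent:
  fixes f :: "nat \<Rightarrow> ('x::topological_space \<Rightarrow>\<^sub>C 'y::complete_space)"
  assumes "Cauchy f"
  shows "convergent f"
proof -
  obtain g where "uniform_limit UNIV f g sequentially"
    using assms uniformly_convergent_eq_cauchy[of "\<lambda>_. True" f]
    unfolding Cauchy_def uniform_limit_sequentially_iff
    by (metis dist_fun_lt_imp_dist_val_lt)
  from uniform_limit_bcontfunE[OF this sequentially_bot] show ?thesis
    by (metis convergentI)
qed

lemma csubspace_c0: "csubspace c0"
  unfolding complex_vector.subspace_def c0_def mem_Collect_eq
proof (intro conjI ballI allI)
  fix a :: complex and x :: "nat \<Rightarrow>\<^sub>C complex"
  assume "x \<in> {x. apply_bcontfun x \<longlonglongrightarrow> 0}"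
  then show "apply_bcontfun (a *\<^sub>C x) \<longlonglongrightarrow> 0"
    using tendsto_mult_right_zero[of "apply_bcontfun x" sequentially a]
    by (simp add: apply_bcontfun_scaleC[abs_def] scaleC_complex_def)
qed (auto simp: zero_bcontfun.rep_eq plus_bcontfun.rep_eq intro: tendsto_add_zero)

lemma closed_c0: "closed c0"
  unfolding closed_sequential_limits
proof (intro allI impI, elim conjE)
  fix c and l assume c: "\<forall>n. c n \<in> (c0 :: (nat \<Rightarrow>\<^sub>C complex) set)" and lim: "c \<longlonglongrightarrow> l"
  show "l \<in> c0"
    unfolding c0_def mem_Collect_eq
  proof (rule LIMSEQ_I)
    fix r :: real assume r: "r > 0"
    have "eventually (\<lambda>n. dist (c n) l < r / 2) sequentially" using lim r by (intro tendstoD) auto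
    then obtain n where n: "dist (c n) l < r / 2" by (auto simp: eventually_sequentially)
    have "(\<lambda>k. apply_bcontfun (c n) k) \<longlonglongrightarrow> 0" using c by (auto simp: c0_def)
    then have "\<exists>K. \<forall>k\<ge>K. norm (apply_bcontfun (c n) k - 0) < r / 2"
      using r by (intro LIMSEQ_D) auto
    then obtain K where K': "\<forall>k\<ge>K. norm (apply_bcontfun (c n) k - 0) < r / 2" ..
    then have K: "norm (apply_bcontfun (c n) k) < r / 2" if "k \<ge> K" for k using that by simp
    have "norm (apply_bcontfun l k) < r" if "k \<ge> K" for k
      using dist_bounded[of "c n" k l] n K[OF that]
        norm_triangle_ineq[of "apply_bcontfun l k - apply_bcontfun (c n) k" "apply_bcontfun (c n) k"]
      by (simp add: dist_norm norm_minus_commute)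
    then show "\<exists>K. \<forall>k\<ge>K. norm (apply_bcontfun l k - 0) < r" by auto
  qed
qed

text \<open>The two bounds make \<open>c \<mapsto> \<Sum>\<^sub>n c\<^sub>n y\<^sub>n\<close> an isomorphism of \<open>c\<^sub>0\<close> onto a closed subspace. With
  \<open>B = \<parallel>c\<parallel>\<close>, taking the supremum over \<open>k\<close> in the lower bound shows that the norm of the sum is at least
  \<open>\<delta> / 2 \<parallel>c\<parallel>\<close>.\<close>

lemma contains_c0I:
  fixes y :: "nat \<Rightarrow> 'a::complex_banach"
  assumes upper: "\<And>F c. finite F \<Longrightarrow> (\<And>n. n \<in> F \<Longrightarrow> cmod (c n) \<le> 1) \<Longrightarrow>
      norm (\<Sum>n\<in>F. c n *\<^sub>C y n) \<le> C"
    and lower: "\<And>K c B k. k < K \<Longrightarrow> (\<And>n. n < K \<Longrightarrow> cmod (c n) \<le> B) \<Longrightarrow>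
      \<delta> * cmod (c k) - \<delta> / 2 * B \<le> norm (\<Sum>n<K. c n *\<^sub>C y n)"
    and \<delta>: "\<delta> > 0"
  shows "contains_c0 TYPE('a)"
proof -
  have C: "C \<ge> 0" using upper[of "{}"] by simp
  have scaled: "norm (\<Sum>n\<in>F. c n *\<^sub>C y n) \<le> C * B"
    if F: "finite F" and B: "\<And>n. n \<in> F \<Longrightarrow> cmod (c n) \<le> B" "B > 0" for F c B
  proof -
    have "(\<Sum>n\<in>F. c n *\<^sub>C y n) = complex_of_real B *\<^sub>C (\<Sum>n\<in>F. (c n / B) *\<^sub>C y n)"
      using B(2) by (simp add: complex_vector.scale_sum_right scaleC_scaleC)
    moreover have "norm (\<Sum>n\<in>F. (c n / B) *\<^sub>C y n) \<le> C"
      using B by (intro upper F) (simp add: norm_divide)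
    ultimately show ?thesis using B(2) by (simp add: norm_scaleC mult.commute)
  qed
  define J :: "(nat \<Rightarrow>\<^sub>C complex) \<Rightarrow> 'a" where "J c = (\<Sum>n. apply_bcontfun c n *\<^sub>C y n)" for c
  have summ: "summable (\<lambda>n. apply_bcontfun c n *\<^sub>C y n)" if "c \<in> c0" for c
    unfolding summable_Cauchy
  proof (intro allI impI)
    fix e :: real assume e: "e > 0"
    define B where "B = e / (2 * (C + 1))"
    have B: "B > 0" "C * B < e"
    proof -
      show "B > 0" using e C by (simp add: B_def)
      have "C * B < (C + 1) * (2 * B)" using \<open>B > 0\<close> C by (simp add: algebra_simps add_nonneg_pos)
      also have "\<dots> = e" using C by (simp add: B_def divide_simps)
      finally show "C * B < e" .
    qed
    have "\<exists>K. \<forall>n\<ge>K. norm (apply_bcontfun c n - 0) < B"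
      using that B(1) unfolding c0_def by (intro LIMSEQ_D) auto
    then obtain K where K: "\<forall>n\<ge>K. norm (apply_bcontfun c n - 0) < B" ..
    have "norm (\<Sum>n\<in>{m..<n}. apply_bcontfun c n *\<^sub>C y n) < e" if "m \<ge> K" for m n
    proof -
      have "norm (\<Sum>n\<in>{m..<n}. apply_bcontfun c n *\<^sub>C y n) \<le> C * B"
        using K that B(1) by (intro scaled) (auto intro: less_imp_le)
      then show ?thesis using B(2) by linarith
    qed
    then show "\<exists>K. \<forall>m\<ge>K. \<forall>n. norm (\<Sum>n\<in>{m..<n}. apply_bcontfun c n *\<^sub>C y n) < e" by blast
  qed
  have J_lim: "(\<lambda>K. \<Sum>n<K. apply_bcontfun c n *\<^sub>C y n) \<longlonglongrightarrow> J c" if "c \<in> c0" for c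
    unfolding J_def by (rule summable_LIMSEQ[OF summ[OF that]])
  have J_add: "J (x + z) = J x + J z" if "x \<in> c0" "z \<in> c0" for x z
    unfolding J_def using suminf_add[OF summ[OF that(1)] summ[OF that(2)]]
    by (simp add: apply_bcontfun_add scaleC_add_left)
  have J_scale: "J (a *\<^sub>C x) = a *\<^sub>C J x" if "x \<in> c0" for a x
    unfolding J_def
    using bounded_linear.suminf[OF bounded_bilinear.bounded_linear_right[OF bounded_bilinear_scaleC] summ[OF that], of a]
    by (simp add: apply_bcontfun_scaleC scaleC_complex_def scaleC_scaleC)
  have diff: "x - z \<in> c0" if "x \<in> c0" "z \<in> c0" for x z
    using complex_vector.subspace_diff[OF csubspace_c0] that by blast
  have J_diff: "J (x - z) = J x - J z" if "x \<in> c0" "z \<in> c0" for x z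
    using J_add[OF diff[OF that] that(2)] by simp
  have J_le: "norm (J x) \<le> C * norm x" if x: "x \<in> c0" for x
  proof (cases "x = 0")
    case True
    then show ?thesis using J_scale[of 0 0] complex_vector.subspace_0[OF csubspace_c0] by simp
  next
    case False
    have "norm (\<Sum>n<K. apply_bcontfun x n *\<^sub>C y n) \<le> C * norm x" for K
      using False by (intro scaled) (auto intro: norm_bounded)
    then show ?thesis
      by (intro tendsto_upperbound[OF tendsto_norm[OF J_lim[OF x]]]) auto
  qed
  have J_ge: "\<delta> / 2 * norm x \<le> norm (J x)" if x: "x \<in> c0" for x
  proof -
    have "cmod (apply_bcontfun x k) \<le> (norm (J x) + \<delta> / 2 * norm x) / \<delta>" for k
    proof -
      have "\<delta> * cmod (apply_bcontfun x k) - \<delta> / 2 * norm x \<le> norm (J x)"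
      proof (rule tendsto_lowerbound[OF tendsto_norm[OF J_lim[OF x]]])
        show "\<forall>\<^sub>F K in sequentially. \<delta> * cmod (apply_bcontfun x k) - \<delta> / 2 * norm x
            \<le> norm (\<Sum>n<K. apply_bcontfun x n *\<^sub>C y n)"
          unfolding eventually_sequentially
          by (intro exI[of _ "Suc k"] allI impI lower norm_bounded) auto
      qed simp
      then show ?thesis using \<delta> by (simp add: field_simps)
    qed
    then have "norm x \<le> (norm (J x) + \<delta> / 2 * norm x) / \<delta>" by (rule norm_bound)
    then show ?thesis using \<delta> by (simp add: field_simps)
  qed
  have inj: "inj_on J c0"
  proof (rule inj_onI)
    fix x z assume xz: "x \<in> c0" "z \<in> c0" "J x = J z"
    then have "\<delta> / 2 * norm (x - z) \<le> 0" using J_ge[OF diff[OF xz(1,2)]] J_diff by simp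
    then show "x = z" using \<delta> by (simp add: mult_le_0_iff)
  qed
  define Y where "Y = J ` c0"
  define G where "G = inv_into c0 J"
  have G: "G (J x) = x" if "x \<in> c0" for x using that inj by (simp add: G_def)
  have J_lip: "dist (J x) (J z) \<le> C * dist x z" and
    G_lip: "dist x z \<le> 2 / \<delta> * dist (J x) (J z)" if "x \<in> c0" "z \<in> c0" for x z
    using J_le[OF diff[OF that]] J_ge[OF diff[OF that]] J_diff[OF that] \<delta>
    by (auto simp: dist_norm field_simps)
  have J_cont: "continuous_on c0 J"
    by (rule lipschitz_on_continuous_on[OF lipschitz_onI]) (use J_lip C in auto)
  have "homeomorphism Y c0 G J"
    unfolding homeomorphism_def
  proof (intro conjI)
    show "continuous_on Y G"
    proof (rule lipschitz_on_continuous_on[OF lipschitz_onI])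
      fix u v assume "u \<in> Y" "v \<in> Y"
      then obtain x z where "x \<in> c0" "z \<in> c0" "u = J x" "v = J z" by (auto simp: Y_def)
      then show "dist (G u) (G v) \<le> 2 / \<delta> * dist u v" using G_lip[of x z] by (simp only: G)
    qed (use \<delta> in simp)
  qed (use J_cont G in \<open>auto simp: Y_def image_image\<close>)
  moreover have "closed Y"
    unfolding closed_sequential_limits
  proof (intro allI impI, elim conjE)
    fix v l assume v: "\<forall>n. v n \<in> Y" and lim: "v \<longlonglongrightarrow> l"
    define c where "c n = G (v n)" for n
    have c: "c n \<in> c0" "J (c n) = v n" for n using v[rule_format, of n] G by (auto simp: c_def Y_def)
    have "Cauchy c"
    proof (rule metric_CauchyI)
      fix e :: real assume e: "e > 0"
      then obtain M where M: "\<And>m n. m \<ge> M \<Longrightarrow> n \<ge> M \<Longrightarrow> dist (v m) (v n) < e * \<delta> / 2"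
      proof -
        have "0 < e * \<delta> / 2" using e \<delta> by simp
        from metric_CauchyD[OF LIMSEQ_imp_Cauchy[OF lim] this] show ?thesis using that by blast
      qed
      have "dist (c m) (c n) < e" if "m \<ge> M" "n \<ge> M" for m n
      proof -
        have "dist (c m) (c n) \<le> 2 / \<delta> * dist (v m) (v n)"
          using G_lip[OF c(1)[of m] c(1)[of n]] by (simp only: c(2))
        also have "\<dots> < 2 / \<delta> * (e * \<delta> / 2)" using \<delta> M[OF that] by (intro mult_strict_left_mono) auto
        also have "\<dots> = e" using \<delta> by simp
        finally show ?thesis .
      qed
      then show "\<exists>M. \<forall>m\<ge>M. \<forall>n\<ge>M. dist (c m) (c n) < e" by blast
    qed
    then have "convergent c" by (rule Cauchy_bcontfun_convergent)
    then obtain x where x: "c \<longlonglongrightarrow> x" by (auto simp: convergent_def)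
    have xc: "x \<in> c0" by (rule closed_sequentially[OF closed_c0 _ x]) (use c(1) in simp)
    have "(\<lambda>n. J (c n)) \<longlonglongrightarrow> J x"
      using J_cont x xc c(1) by (simp add: continuous_on_sequentially o_def)
    then have "J x = l" using LIMSEQ_unique[OF _ lim] c(2) by simp
    then show "l \<in> Y" using xc by (auto simp: Y_def)
  qed
  moreover have "csubspace Y"
    unfolding complex_vector.subspace_def Y_def
  proof (intro conjI ballI allI)
    have c00: "0 \<in> c0" using complex_vector.subspace_0[OF csubspace_c0] .
    then have "J 0 = 0" using J_scale[of 0 0] by simp
    then show "0 \<in> J ` c0" using c00 by (metis image_eqI)
    fix u assume u: "u \<in> J ` c0"
    show "a *\<^sub>C u \<in> J ` c0" for a
      using u J_scale[symmetric] complex_vector.subspace_scale[OF csubspace_c0] by auto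
    show "u + v \<in> J ` c0" if "v \<in> J ` c0" for v
      using u that J_add[symmetric] complex_vector.subspace_add[OF csubspace_c0] by auto
  qed
  moreover have "G (u + v) = G u + G v" if "u \<in> Y" "v \<in> Y" for u v
    using that G J_add complex_vector.subspace_add[OF csubspace_c0] by (force simp: Y_def)
  moreover have "G (a *\<^sub>C u) = a *\<^sub>C G u" if "u \<in> Y" for a u
    using that G J_scale complex_vector.subspace_scale[OF csubspace_c0] by (force simp: Y_def)
  ultimately show ?thesis
    unfolding contains_c0_def isomorphic_subspaces_def by blast
qed

text \<open>Otherwise there are disjoint blocks \<open>y\<^sub>k\<close> of the series with norm at least \<open>e\<close>. Weak summability and uniform
  boundedness give the upper bound of \<open>contains_c0I\<close> for the blocks. It also bounds the row sums of the matrix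
  \<open>|\<phi>\<^sub>k(y\<^sub>m)|\<close> formed with norming functionals of the blocks. By Rosenthal's lemma, along a sequence of blocks the
  functional \<open>\<phi>\<^sub>k\<close> nearly ignores the blocks other than \<open>y\<^sub>k\<close>, which is the lower bound. So the space would contain
  \<open>c\<^sub>0\<close>.\<close>

theorem bessaga_pelczynski:
  fixes x :: "'i \<Rightarrow> 'a::complex_banach"
  assumes no_c0: "\<not> contains_c0 TYPE('a)"
    and weak: "\<And>\<phi>. \<phi> \<in> dual \<Longrightarrow> \<exists>B. \<forall>F. finite F \<longrightarrow> (\<Sum>n\<in>F. cmod (\<phi> (x n))) \<le> B"
  shows "unconditionally_cauchy x"
proof (rule ccontr)
  define V where "V = {\<Sum>n\<in>F. c n *\<^sub>C x n | F c. finite F \<and> (\<forall>n\<in>F. cmod (c n) \<le> 1)}"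
  have "\<exists>C\<ge>0. \<forall>v\<in>V. norm v \<le> C"
  proof (rule weakly_bounded_imp_bounded)
    fix \<phi> :: "'a \<Rightarrow> complex" assume \<phi>: "\<phi> \<in> dual"
    then interpret \<phi>: bounded_linear \<phi> by (simp add: dual_def bounded_clinear_def)
    have \<phi>_scale: "\<phi> (a *\<^sub>C v) = a * \<phi> v" for a v
      using \<phi> by (simp add: dual_def bounded_clinear_def scaleC_complex_def)
    obtain B where B: "\<forall>F. finite F \<longrightarrow> (\<Sum>n\<in>F. cmod (\<phi> (x n))) \<le> B" using weak[OF \<phi>] ..
    have "cmod (\<phi> (\<Sum>n\<in>F. c n *\<^sub>C x n)) \<le> B"
      if "finite F" "\<forall>n\<in>F. cmod (c n) \<le> 1" for F c
    proof -
      have "cmod (\<phi> (\<Sum>n\<in>F. c n *\<^sub>C x n)) \<le> (\<Sum>n\<in>F. cmod (\<phi> (x n)))"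
        unfolding \<phi>.sum \<phi>_scale
        by (rule sum_norm_le) (use that in \<open>simp add: norm_mult mult_left_le_one_le\<close>)
      then show ?thesis using B that by force
    qed
    then show "\<exists>B. \<forall>v\<in>V. cmod (\<phi> v) \<le> B" unfolding V_def by (intro exI[of _ B]) auto
  qed
  then obtain C where C: "\<forall>v\<in>V. norm v \<le> C" by blast
  have upper_x: "norm (\<Sum>n\<in>F. c n *\<^sub>C x n) \<le> C" if "finite F" "\<And>n. n \<in> F \<Longrightarrow> cmod (c n) \<le> 1" for F c
    using C that unfolding V_def by blast
  assume "\<not> unconditionally_cauchy x"
  then have "\<exists>e>0. \<forall>G. finite G \<longrightarrow> (\<exists>F. finite F \<and> F \<inter> G = {} \<and> e \<le> norm (sum x F))"
    by (simp add: unconditionally_cauchy_def not_less conj_assoc)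
  then obtain e where e: "e > 0"
    and far: "\<forall>G. finite G \<longrightarrow> (\<exists>F. finite F \<and> F \<inter> G = {} \<and> e \<le> norm (sum x F))" by auto
  have "\<forall>G. \<exists>F. finite G \<longrightarrow> finite F \<and> F \<inter> G = {} \<and> e \<le> norm (sum x F)"
    using far by simp
  from choice[OF this] obtain \<Phi> where
    \<Phi>: "\<forall>G. finite G \<longrightarrow> finite (\<Phi> G) \<and> \<Phi> G \<inter> G = {} \<and> e \<le> norm (sum x (\<Phi> G))" ..
  define G where "G = rec_nat {} (\<lambda>_ H. H \<union> \<Phi> H)"
  have G_Suc: "G (Suc k) = G k \<union> \<Phi> (G k)" and G_0: "G 0 = {}" for k by (simp_all add: G_def)
  have G_fin: "finite (G k)" for k by (induction k) (use \<Phi> in \<open>auto simp: G_Suc G_0\<close>)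
  define F where "F k = \<Phi> (G k)" for k
  have F: "finite (F k)" "F k \<inter> G k = {}" "e \<le> norm (sum x (F k))" for k
    using \<Phi> G_fin[of k] by (auto simp: F_def)
  have F_G: "F j \<subseteq> G k" if "j < k" for j k
    using that by (induction k) (auto simp: G_Suc F_def less_Suc_eq)
  have F_disj: "F j \<inter> F k = {}" if "j \<noteq> k" for j k
    using that F_G[of j k] F_G[of k j] F(2)[of j] F(2)[of k] by (cases j k rule: linorder_cases) auto
  define y where "y k = sum x (F k)" for k
  have upper_y: "norm (\<Sum>k\<in>K. c k *\<^sub>C y k) \<le> C"
    if K: "finite K" and c: "\<And>k. k \<in> K \<Longrightarrow> cmod (c k) \<le> 1" for K c
  proof -
    define lab where "lab n = (THE k. n \<in> F k)" for n
    have lab: "lab n = k" if "n \<in> F k" for n k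
      unfolding lab_def using that F_disj by (intro the_equality) auto
    have "(\<Sum>k\<in>K. c k *\<^sub>C y k) = (\<Sum>k\<in>K. \<Sum>n\<in>F k. c (lab n) *\<^sub>C x n)"
      by (auto simp: y_def complex_vector.scale_sum_right lab intro!: sum.cong)
    also have "\<dots> = (\<Sum>n\<in>(\<Union>k\<in>K. F k). c (lab n) *\<^sub>C x n)"
      using K F(1) F_disj by (intro sum.UNION_disjoint[symmetric]) auto
    also have "norm \<dots> \<le> C"
      using K F(1) c lab by (intro upper_x) auto
    finally show ?thesis .
  qed
  have "\<forall>k. \<exists>\<phi>. \<phi> \<in> dual \<and> (\<forall>v. cmod (\<phi> v) \<le> norm v) \<and> cmod (\<phi> (y k)) = norm (y k)"
    by (metis norming_functional)
  from choice[OF this] obtain \<phi> where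
    \<phi>: "\<forall>k. \<phi> k \<in> dual \<and> (\<forall>v. cmod (\<phi> k v) \<le> norm v) \<and> cmod (\<phi> k (y k)) = norm (y k)" ..
  have \<phi>_lin: "bounded_linear (\<phi> k)" and \<phi>_scale: "\<phi> k (a *\<^sub>C v) = a * \<phi> k v" for k a v
    using \<phi> by (auto simp: dual_def bounded_clinear_def scaleC_complex_def)
  have rows: "(\<Sum>m\<in>K. cmod (\<phi> k (y m))) \<le> C" if K: "finite K" for k K
  proof -
    define c where "c m = cnj (sgn (\<phi> k (y m)))" for m
    have "c m * \<phi> k (y m) = cmod (\<phi> k (y m))" for m
      using complex_norm_square[of "\<phi> k (y m)"]
      by (cases "\<phi> k (y m) = 0") (auto simp: c_def sgn_eq field_simps power2_eq_square)
    then have "\<phi> k (\<Sum>m\<in>K. c m *\<^sub>C y m) = of_real (\<Sum>m\<in>K. cmod (\<phi> k (y m)))"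
      by (simp add: linear_sum[OF bounded_linear.linear[OF \<phi>_lin]] \<phi>_scale)
    then have "(\<Sum>m\<in>K. cmod (\<phi> k (y m))) \<le> cmod (\<phi> k (\<Sum>m\<in>K. c m *\<^sub>C y m))"
      by (metis abs_ge_self norm_of_real)
    also have "\<dots> \<le> norm (\<Sum>m\<in>K. c m *\<^sub>C y m)" using \<phi> by blast
    also have "\<dots> \<le> C" by (intro upper_y K) (simp add: c_def norm_sgn)
    finally show ?thesis .
  qed
  obtain s :: "nat \<Rightarrow> nat" where s: "inj s"
    "\<And>k K. finite K \<Longrightarrow> k \<notin> K \<Longrightarrow> (\<Sum>m\<in>K. cmod (\<phi> (s k) (y (s m)))) \<le> e / 2"
    using rosenthal_matrix[of "\<lambda>k m. cmod (\<phi> k (y m))" C "e / 2"] rows e by auto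
  have "contains_c0 TYPE('a)"
  proof (rule contains_c0I[where y = "\<lambda>n. y (s n)" and C = C and \<delta> = e])
    fix K :: "nat set" and c :: "nat \<Rightarrow> complex"
    assume K: "finite K" and c: "\<And>n. n \<in> K \<Longrightarrow> cmod (c n) \<le> 1"
    have "(\<Sum>n\<in>K. c n *\<^sub>C y (s n)) = (\<Sum>m\<in>s ` K. c (inv s m) *\<^sub>C y m)"
      using s(1) by (subst sum.reindex) (auto intro: inj_on_subset)
    also have "norm \<dots> \<le> C" using K c s(1) by (intro upper_y) auto
    finally show "norm (\<Sum>n\<in>K. c n *\<^sub>C y (s n)) \<le> C" .
  next
    fix K k :: nat and c :: "nat \<Rightarrow> complex" and B :: real
    assume k: "k < K" and c: "\<And>n. n < K \<Longrightarrow> cmod (c n) \<le> B"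
    have B: "B \<ge> 0" by (rule order_trans[OF norm_ge_zero c[OF k]])
    let ?v = "\<Sum>n<K. c n *\<^sub>C y (s n)" and ?a = "\<lambda>n. c n * \<phi> (s k) (y (s n))"
    have "\<phi> (s k) ?v = (\<Sum>n<K. ?a n)"
      by (simp add: linear_sum[OF bounded_linear.linear[OF \<phi>_lin]] \<phi>_scale)
    also have "\<dots> = ?a k + (\<Sum>n\<in>{..<K} - {k}. ?a n)" using k by (intro sum.remove) auto
    finally have "cmod (?a k) \<le> cmod (\<phi> (s k) ?v) + cmod (\<Sum>n\<in>{..<K} - {k}. ?a n)"
      using norm_triangle_ineq4[of "\<phi> (s k) ?v" "\<Sum>n\<in>{..<K} - {k}. ?a n"] by simp
    moreover have "cmod (\<Sum>n\<in>{..<K} - {k}. ?a n) \<le> e / 2 * B"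
    proof -
      have "cmod (\<Sum>n\<in>{..<K} - {k}. ?a n) \<le> (\<Sum>n\<in>{..<K} - {k}. B * cmod (\<phi> (s k) (y (s n))))"
        by (rule sum_norm_le) (use c in \<open>auto simp: norm_mult intro!: mult_right_mono\<close>)
      also have "\<dots> \<le> B * (e / 2)"
        unfolding sum_distrib_left[symmetric] using B s(2) by (intro mult_left_mono) auto
      finally show ?thesis by (simp add: mult.commute)
    qed
    moreover have "cmod (\<phi> (s k) ?v) \<le> norm ?v" using \<phi> by blast
    moreover have "e * cmod (c k) \<le> cmod (?a k)"
      using \<phi> mult_left_mono[OF F(3)[of "s k"], of "cmod (c k)"]
      by (simp add: norm_mult y_def mult.commute)
    ultimately show "e * cmod (c k) - e / 2 * B \<le> norm ?v" by linarith
  qed (rule e)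
  then show False using no_c0 by contradiction
qed


section \<open>Decay of Fourier coefficients\<close>

lemma sum_inverse_squares_bounded:
  obtains S :: real where "\<And>F :: int set. finite F \<Longrightarrow> (\<Sum>n\<in>F. 1 / (real_of_int n)\<^sup>2) \<le> S"
proof
  define q where "q k = inverse (real k ^ 2)" for k
  have q: "summable q" unfolding q_def by (rule inverse_power_summable) simp
  fix F :: "int set" assume F: "finite F"
  have half: "(\<Sum>n\<in>H. 1 / (real_of_int n)\<^sup>2) \<le> suminf q"
    if H: "finite H" "inj_on (nat \<circ> abs) H" for H
  proof -
    have "(\<Sum>n\<in>H. 1 / (real_of_int n)\<^sup>2) = (\<Sum>n\<in>H. q ((nat \<circ> abs) n))"
      by (auto simp: q_def inverse_eq_divide intro!: sum.cong)
    also have "\<dots> = sum q ((nat \<circ> abs) ` H)"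
      using sum.reindex[OF H(2), of q] by (simp add: o_def)
    also have "\<dots> \<le> suminf q" using q H(1) by (intro sum_le_suminf) (auto simp: q_def)
    finally show ?thesis .
  qed
  have "(\<Sum>n\<in>F. 1 / (real_of_int n)\<^sup>2)
      = (\<Sum>n\<in>F \<inter> {0..}. 1 / (real_of_int n)\<^sup>2) + (\<Sum>n\<in>F - {0..}. 1 / (real_of_int n)\<^sup>2)"
    using F by (rule sum.Int_Diff)
  also have "\<dots> \<le> suminf q + suminf q"
    using F by (intro add_mono half) (auto simp: inj_on_def)
  finally show "(\<Sum>n\<in>F. 1 / (real_of_int n)\<^sup>2) \<le> suminf q + suminf q" .
qed

text \<open>Some finite \<open>G\<close> brings the sum of \<open>r\<close> close to the supremum of all finite sums, which leaves little for finite
  sets disjoint from \<open>G\<close>.\<close>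

lemma dominated_imp_unconditionally_cauchy:
  fixes x :: "'i \<Rightarrow> 'x::real_normed_vector"
  assumes le: "\<And>n. norm (x n) \<le> r n" and bdd: "\<And>F. finite F \<Longrightarrow> sum r F \<le> (S :: real)"
  shows "unconditionally_cauchy x"
  unfolding unconditionally_cauchy_def
proof (intro allI impI)
  fix e :: real assume e: "e > 0"
  define R where "R = sum r ` {F. finite F}"
  have R: "R \<noteq> {}" "bdd_above R" using bdd by (auto simp: R_def intro!: bdd_aboveI)
  have "Sup R - e < Sup R" using e by simp
  then obtain v where "v \<in> R" "Sup R - e < v" using less_cSup_iff[OF R] by blast
  then obtain G where G: "finite G" "Sup R - e < sum r G" by (auto simp: R_def)
  have "norm (sum x F) < e" if F: "finite F" "F \<inter> G = {}" for F
  proof -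
    have "norm (sum x F) \<le> sum r F" by (rule sum_norm_le) (rule le)
    moreover have "sum r (F \<union> G) = sum r F + sum r G" using F G by (intro sum.union_disjoint) auto
    moreover have "sum r (F \<union> G) \<le> Sup R" using F G R by (intro cSup_upper) (auto simp: R_def)
    ultimately show ?thesis using G by linarith
  qed
  then show "\<exists>G. finite G \<and> (\<forall>F. finite F \<and> F \<inter> G = {} \<longrightarrow> norm (sum x F) < e)"
    using G(1) by blast
qed

lemma has_vector_derivative_cis:
  "((\<lambda>s. cis (c * s)) has_vector_derivative (\<i> * of_real c * cis (c * s))) (at s within X)"
  by (rule has_vector_derivative_at_within)
    (auto intro!: derivative_eq_intros simp: scaleR_conv_of_real has_vector_derivative_def algebra_simps)

lemma integral_cis_period:
  fixes k :: int
  shows "integral {a..a + 2 * pi} (\<lambda>s. cis (of_int k * s)) = (if k = 0 then 2 * pi else 0)"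
proof (cases "k = 0")
  case False
  have "((\<lambda>s. cis (of_int k * s)) has_integral
      cis (of_int k * (a + 2 * pi)) / (\<i> * k) - cis (of_int k * a) / (\<i> * k)) {a..a + 2 * pi}"
  proof (rule fundamental_theorem_of_calculus)
    fix s :: real
    have "((\<lambda>s. cis (of_int k * s) * (1 / (\<i> * k))) has_vector_derivative
        \<i> * of_real k * cis (of_int k * s) * (1 / (\<i> * k))) (at s within {a..a + 2 * pi})"
      by (rule bounded_linear.has_vector_derivative[OF bounded_linear_mult_left has_vector_derivative_cis])
    then show "((\<lambda>s. cis (of_int k * s) / (\<i> * k)) has_vector_derivative cis (of_int k * s)) (at s within {a..a + 2 * pi})"
      using False by simp
  qed simp
  moreover have "cis (of_int k * (a + 2 * pi)) = cis (of_int k * a)"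
  proof -
    have "cis (of_int k * (a + 2 * pi)) = cis (of_int k * a) * cis (2 * pi * of_int k)"
      by (simp add: cis_mult algebra_simps)
    then show ?thesis by simp
  qed
  ultimately show ?thesis using False by (simp add: integral_unique)
qed (simp add: scaleR_conv_of_real)

text \<open>Parseval's identity for trigonometric polynomials.\<close>

lemma integral_trig_polynomial_square:
  fixes F :: "int set" and \<eta> :: "int \<Rightarrow> complex"
  assumes "finite F"
  shows "integral {a..a + 2 * pi} (\<lambda>s. (cmod (\<Sum>n\<in>F. \<eta> n * cis (of_int n * s)))\<^sup>2)
    = 2 * pi * (\<Sum>n\<in>F. (cmod (\<eta> n))\<^sup>2)"
proof -
  let ?I = "{a..a + 2 * pi}"
  define P where "P s = (\<Sum>n\<in>F. \<eta> n * cis (of_int n * s))" for s :: real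
  have P_cont: "continuous_on ?I P" unfolding P_def by (intro continuous_intros)
  have sq: "complex_of_real ((cmod (P s))\<^sup>2)
      = (\<Sum>n\<in>F. \<Sum>m\<in>F. (\<eta> n * cnj (\<eta> m)) * cis (real_of_int (n - m) * s))" for s
    unfolding complex_norm_square P_def
    by (simp add: sum_product cis_cnj cis_mult algebra_simps flip: cis_mult[of "_ * _"])
  have "complex_of_real (integral ?I (\<lambda>s. (cmod (P s))\<^sup>2))
      = integral ?I (\<lambda>s. complex_of_real ((cmod (P s))\<^sup>2))"
    by (subst integral_linear[OF _ bounded_linear_of_real, unfolded o_def])
       (auto intro!: integrable_continuous_real continuous_intros P_cont)
  also have "\<dots> = (\<Sum>n\<in>F. \<Sum>m\<in>F. (\<eta> n * cnj (\<eta> m)) * integral ?I (\<lambda>s. cis (real_of_int (n - m) * s)))"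
    unfolding sq
    by (intro integral_unique has_integral_sum assms has_integral_mult_right integrable_integral
        integrable_continuous_real continuous_intros)
  also have "\<dots> = (\<Sum>n\<in>F. \<Sum>m\<in>F. if m = n then 2 * pi * (\<eta> n * cnj (\<eta> n)) else 0)"
    unfolding integral_cis_period by (intro sum.cong) (auto simp: mult.commute)
  also have "\<dots> = (\<Sum>n\<in>F. 2 * pi * (\<eta> n * cnj (\<eta> n)))"
    using assms by simp
  also have "\<dots> = complex_of_real (2 * pi * (\<Sum>n\<in>F. (cmod (\<eta> n))\<^sup>2))"
    by (simp add: sum_distrib_left flip: complex_norm_square of_real_power)
  finally show ?thesis unfolding P_def of_real_eq_iff .
qed

text \<open>Up to a unimodular factor, the coefficient of \<open>g\<close> at \<open>n \<noteq> 0\<close> is \<open>1/n\<close> times the coefficient of \<open>g'\<close>. So the sum of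
  the moduli over \<open>n \<noteq> 0\<close> is \<open>\<integral> P g'\<close> for a trigonometric polynomial \<open>P\<close> with coefficients of modulus at most \<open>1/|n|\<close>, and
  \<open>|P g'| \<le> (|P|\<^sup>2 + |g'|\<^sup>2) / 2\<close> together with Parseval bounds it independently of the finite index set.\<close>

lemma fourier_coefficients_summable:
  fixes g g' :: "real \<Rightarrow> complex"
  assumes ab: "a \<le> b" "b \<le> a + 2 * pi"
    and deriv: "\<And>s. s \<in> {a..b} \<Longrightarrow> (g has_vector_derivative g' s) (at s within {a..b})"
    and cont: "continuous_on {a..b} g'" and zero: "g a = 0" "g b = 0"
  obtains B where "\<And>F :: int set. finite F \<Longrightarrow>
    (\<Sum>n\<in>F. cmod (integral {a..b} (\<lambda>s. cis (of_int n * s) * g s))) \<le> B"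
proof -
  obtain S where S: "\<And>F :: int set. finite F \<Longrightarrow> (\<Sum>n\<in>F. 1 / (real_of_int n)\<^sup>2) \<le> S"
    using sum_inverse_squares_bounded by blast
  define c where "c n = integral {a..b} (\<lambda>s. cis (real_of_int n * s) * g s)" for n
  define d where "d n = integral {a..b} (\<lambda>s. cis (real_of_int n * s) * g' s)" for n
  have g_cont: "continuous_on {a..b} g"
    unfolding continuous_on_eq_continuous_within
    by (intro ballI has_vector_derivative_continuous[OF deriv])
  have int1: "(\<lambda>s. cis (real_of_int n * s) * h s) integrable_on {a..b}" if "continuous_on {a..b} h" for h n
    by (intro integrable_continuous_real continuous_intros that)
  have cd: "cmod (c n) = cmod (d n) / \<bar>n\<bar>" if n: "n \<noteq> 0" for n
  proof -
    have "((\<lambda>s. \<i> * of_int n * (cis (real_of_int n * s) * g s) + cis (real_of_int n * s) * g' s)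
        has_integral cis (of_int n * b) * g b - cis (of_int n * a) * g a) {a..b}"
    proof (rule fundamental_theorem_of_calculus[OF ab(1)])
      fix s assume s: "s \<in> {a..b}"
      show "((\<lambda>s. cis (real_of_int n * s) * g s) has_vector_derivative
          \<i> * of_int n * (cis (real_of_int n * s) * g s) + cis (real_of_int n * s) * g' s) (at s within {a..b})"
        using has_vector_derivative_mult[OF has_vector_derivative_cis[of "of_int n" s] deriv[OF s]]
        by (simp add: algebra_simps)
    qed
    then have "0 = integral {a..b} (\<lambda>s. \<i> * of_int n * (cis (real_of_int n * s) * g s) + cis (real_of_int n * s) * g' s)"
      using zero by (simp add: integral_unique)
    also have "\<dots> = \<i> * of_int n * c n + d n"
      unfolding c_def d_def
      by (subst integral_add) (auto intro!: integrable_on_mult_right int1 g_cont cont)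
    finally have "d n = - (\<i> * of_int n * c n)" by (simp add: eq_neg_iff_add_eq_0 add.commute)
    then show ?thesis using n by (simp add: norm_mult)
  qed
  define A where "A = integral {a..b} (\<lambda>s. (cmod (g' s))\<^sup>2)"
  have nonzero: "(\<Sum>n\<in>F. cmod (c n)) \<le> A / 2 + pi * S" if F: "finite F" "0 \<notin> F" for F
  proof -
    \<comment> \<open>The coefficients are chosen to turn \<open>\<integral> P g'\<close> into the sum of the moduli.\<close>
    define \<eta> where "\<eta> n = cnj (sgn (d n)) / of_real \<bar>of_int n\<bar>" for n
    define P where "P s = (\<Sum>n\<in>F. \<eta> n * cis (real_of_int n * s))" for s
    have P_cont: "continuous_on X P" for X unfolding P_def by (intro continuous_intros)
    have "\<eta> n * d n = of_real (cmod (c n))" if "n \<in> F" for n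
    proof -
      have "n \<noteq> 0" using that F by auto
      moreover have "cnj (sgn (d n)) * d n = of_real (cmod (d n))"
        using complex_norm_square[of "d n"]
        by (cases "d n = 0") (auto simp: sgn_eq field_simps power2_eq_square)
      ultimately show ?thesis using cd by (simp add: \<eta>_def)
    qed
    then have "of_real (\<Sum>n\<in>F. cmod (c n)) = (\<Sum>n\<in>F. \<eta> n * d n)" by simp
    also have "\<dots> = integral {a..b} (\<lambda>s. \<Sum>n\<in>F. \<eta> n * (cis (real_of_int n * s) * g' s))"
      unfolding d_def using F by (subst integral_sum) (auto intro!: integrable_on_mult_right int1 cont)
    also have "\<dots> = integral {a..b} (\<lambda>s. P s * g' s)"
      by (simp add: P_def sum_distrib_right mult.assoc)
    finally have "(\<Sum>n\<in>F. cmod (c n)) \<le> cmod (integral {a..b} (\<lambda>s. P s * g' s))"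
      by (metis abs_ge_self norm_of_real)
    also have "\<dots> \<le> integral {a..b} (\<lambda>s. ((cmod (g' s))\<^sup>2 + (cmod (P s))\<^sup>2) / 2)"
    proof (rule integral_norm_bound_integral)
      show "cmod (P s * g' s) \<le> ((cmod (g' s))\<^sup>2 + (cmod (P s))\<^sup>2) / 2" for s
        using sum_squares_bound[of "cmod (P s)" "cmod (g' s)"] by (simp add: norm_mult)
    qed (intro integrable_continuous_real continuous_intros P_cont cont; simp)+
    also have "\<dots> = A / 2 + integral {a..b} (\<lambda>s. (cmod (P s))\<^sup>2) / 2"
      unfolding A_def add_divide_distrib
      by (subst integral_add) (auto intro!: integrable_continuous_real continuous_intros P_cont cont)
    also have "integral {a..b} (\<lambda>s. (cmod (P s))\<^sup>2) \<le> integral {a..a + 2 * pi} (\<lambda>s. (cmod (P s))\<^sup>2)"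
      by (rule integral_subset_le)
         (use ab in \<open>auto intro!: integrable_continuous_real continuous_intros P_cont\<close>)
    also have "\<dots> = 2 * pi * (\<Sum>n\<in>F. (cmod (\<eta> n))\<^sup>2)"
      unfolding P_def by (rule integral_trig_polynomial_square[OF F(1)])
    also have "(\<Sum>n\<in>F. (cmod (\<eta> n))\<^sup>2) \<le> (\<Sum>n\<in>F. 1 / (real_of_int n)\<^sup>2)"
      by (rule sum_mono) (auto simp: \<eta>_def norm_divide norm_sgn power_divide)
    also have "\<dots> \<le> S" by (rule S[OF F(1)])
    finally show ?thesis by simp
  qed
  show thesis
  proof (rule that[of "cmod (c 0) + (A / 2 + pi * S)"])
    fix F :: "int set" assume F: "finite F"
    have "(\<Sum>n\<in>F. cmod (c n)) \<le> (\<Sum>n\<in>insert 0 (F - {0}). cmod (c n))"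
      using F by (intro sum_mono2) auto
    also have "\<dots> = cmod (c 0) + (\<Sum>n\<in>F - {0}. cmod (c n))" using F by (subst sum.insert) auto
    also have "\<dots> \<le> cmod (c 0) + (A / 2 + pi * S)" using F by (intro add_left_mono nonzero) auto
    finally show "(\<Sum>n\<in>F. cmod (integral {a..b} (\<lambda>s. cis (real_of_int n * s) * g s))) \<le> cmod (c 0) + (A / 2 + pi * S)"
      by (simp add: c_def)
  qed
qed

lemma fourier_coefficients_C2:
  fixes h h' h'' :: "real \<Rightarrow> 'a::complex_banach"
  assumes ab: "a \<le> b"
    and h: "\<And>s. s \<in> {a..b} \<Longrightarrow> (h has_vector_derivative h' s) (at s within {a..b})"
    and h': "\<And>s. s \<in> {a..b} \<Longrightarrow> (h' has_vector_derivative h'' s) (at s within {a..b})"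
    and cont: "continuous_on {a..b} h''"
    and zero: "h a = 0" "h b = 0" "h' a = 0" "h' b = 0"
  shows "unconditionally_cauchy (\<lambda>n :: int. integral {a..b} (\<lambda>s. cis (of_int n * s) *\<^sub>C h s))"
proof -
  obtain S where S: "\<And>F :: int set. finite F \<Longrightarrow> (\<Sum>n\<in>F. 1 / (real_of_int n)\<^sup>2) \<le> S"
    using sum_inverse_squares_bounded by blast
  define c where "c n = integral {a..b} (\<lambda>s. cis (real_of_int n * s) *\<^sub>C h s)" for n
  have h_cont: "continuous_on {a..b} h"
    unfolding continuous_on_eq_continuous_within
    by (intro ballI has_vector_derivative_continuous[OF h])
  have "compact (h'' ` {a..b})" by (intro compact_continuous_image cont) simp
  then obtain M where M: "\<And>s. s \<in> {a..b} \<Longrightarrow> norm (h'' s) \<le> M" "M \<ge> 0"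
    by (metis bounded_pos compact_imp_bounded image_eqI less_imp_le)
  define K where "K = M * (b - a)"
  have decay: "norm (c n) \<le> K * (1 / (real_of_int n)\<^sup>2)" if n: "n \<noteq> 0" for n
  proof -
    define N where "N = complex_of_real n"
    have N: "N \<noteq> 0" using n by (simp add: N_def)
    \<comment> \<open>This antiderivative performs both integrations by parts at once.\<close>
    let ?H = "\<lambda>s. cis (of_int n * s) *\<^sub>C (((1 / (\<i> * N)) *\<^sub>C h s) + (1 / N\<^sup>2) *\<^sub>C h' s)"
    have "((\<lambda>s. cis (of_int n * s) *\<^sub>C h s + (1 / N\<^sup>2) *\<^sub>C (cis (of_int n * s) *\<^sub>C h'' s)) has_integral ?H b - ?H a) {a..b}"
    proof (rule fundamental_theorem_of_calculus[OF ab])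
      fix s assume s: "s \<in> {a..b}"
      have "((\<lambda>s. ((1 / (\<i> * N)) *\<^sub>C h s) + (1 / N\<^sup>2) *\<^sub>C h' s) has_vector_derivative
          ((1 / (\<i> * N)) *\<^sub>C h' s) + (1 / N\<^sup>2) *\<^sub>C h'' s) (at s within {a..b})"
        by (intro has_vector_derivative_add h[OF s] h'[OF s]
            bounded_linear.has_vector_derivative[OF bounded_bilinear.bounded_linear_right[OF bounded_bilinear_scaleC]])
      from has_vector_derivative_scaleC[OF has_vector_derivative_cis[of "of_int n" s] this]
      have "(?H has_vector_derivative
          cis (of_int n * s) *\<^sub>C (((1 / (\<i> * N)) *\<^sub>C h' s) + (1 / N\<^sup>2) *\<^sub>C h'' s) +
          (\<i> * N * cis (of_int n * s)) *\<^sub>C (((1 / (\<i> * N)) *\<^sub>C h s) + (1 / N\<^sup>2) *\<^sub>C h' s)) (at s within {a..b})"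
        by (simp add: N_def)
      also have "cis (of_int n * s) *\<^sub>C (((1 / (\<i> * N)) *\<^sub>C h' s) + (1 / N\<^sup>2) *\<^sub>C h'' s) +
          (\<i> * N * cis (of_int n * s)) *\<^sub>C (((1 / (\<i> * N)) *\<^sub>C h s) + (1 / N\<^sup>2) *\<^sub>C h' s)
        = cis (of_int n * s) *\<^sub>C h s + (1 / N\<^sup>2) *\<^sub>C (cis (of_int n * s) *\<^sub>C h'' s)
          + (cis (of_int n * s) * (1 / (\<i> * N) + \<i> * N / N\<^sup>2)) *\<^sub>C h' s"
        using N by (simp add: scaleC_add_right scaleC_add_left scaleC_scaleC algebra_simps)
      also have "1 / (\<i> * N) + \<i> * N / N\<^sup>2 = 0"
        using N by (simp add: field_simps power2_eq_square)
      finally show "(?H has_vector_derivative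
          cis (of_int n * s) *\<^sub>C h s + (1 / N\<^sup>2) *\<^sub>C (cis (of_int n * s) *\<^sub>C h'' s)) (at s within {a..b})"
        by simp
    qed
    then have "((\<lambda>s. cis (of_int n * s) *\<^sub>C h s + (1 / N\<^sup>2) *\<^sub>C (cis (of_int n * s) *\<^sub>C h'' s)) has_integral 0) {a..b}"
      using zero by simp
    from has_integral_diff[OF this, of "\<lambda>s. cis (of_int n * s) *\<^sub>C h s" "c n"]
    have "((\<lambda>s. (1 / N\<^sup>2) *\<^sub>C (cis (of_int n * s) *\<^sub>C h'' s)) has_integral - c n) {a..b}"
      if "((\<lambda>s. cis (of_int n * s) *\<^sub>C h s) has_integral c n) {a..b}"
      using that by simp
    moreover have "((\<lambda>s. cis (of_int n * s) *\<^sub>C h s) has_integral c n) {a..b}"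
      unfolding c_def by (intro integrable_integral integrable_continuous_real continuous_intros h_cont)
    ultimately have "((\<lambda>s. (1 / N\<^sup>2) *\<^sub>C (cis (of_int n * s) *\<^sub>C h'' s)) has_integral - c n) {a..b}" .
    then have "norm (- c n) \<le> M / (real_of_int n)\<^sup>2 * measure lborel {a..b}"
    proof (rule has_integral_bound_real[rotated 2])
      show "norm ((1 / N\<^sup>2) *\<^sub>C (cis (of_int n * s) *\<^sub>C h'' s)) \<le> M / (real_of_int n)\<^sup>2"
        if "s \<in> {a..b} - {}" for s
        using that M(1) by (simp add: norm_scaleC norm_divide norm_power N_def divide_right_mono)
    qed (use M(2) in auto)
    then have "norm (- c n) \<le> M / (real_of_int n)\<^sup>2 * (b - a)"
      using ab by simp
    then show ?thesis by (simp add: K_def)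
  qed
  have K: "K \<ge> 0" using M(2) ab by (simp add: K_def)
  have "unconditionally_cauchy c"
  proof (rule dominated_imp_unconditionally_cauchy)
    let ?r = "\<lambda>n. (if n = 0 then norm (c 0) else 0) + K * (1 / (real_of_int n)\<^sup>2)"
    show "norm (c n) \<le> ?r n" for n using decay[of n] by auto
    fix F :: "int set" assume F: "finite F"
    have "sum ?r F = (\<Sum>n\<in>F. if n = 0 then norm (c 0) else 0) + K * (\<Sum>n\<in>F. 1 / (real_of_int n)\<^sup>2)"
      by (simp add: sum.distrib sum_distrib_left)
    also have "\<dots> \<le> norm (c 0) + K * S"
      using F S[OF F] K by (intro add_mono mult_left_mono) auto
    finally show "sum ?r F \<le> norm (c 0) + K * S" .
  qed
  then show ?thesis by (simp add: c_def[abs_def])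
qed


section \<open>A criterion for frequent hypercyclicity\<close>

lemma unconditionally_cauchy_add:
  assumes "unconditionally_cauchy x" "unconditionally_cauchy y"
  shows "unconditionally_cauchy (\<lambda>n. x n + y n)"
  unfolding unconditionally_cauchy_def
proof (intro allI impI)
  fix e :: real assume "e > 0"
  then have "e / 2 > 0" by simp
  obtain G where G: "finite G" "\<forall>F. finite F \<and> F \<inter> G = {} \<longrightarrow> norm (sum x F) < e / 2"
    using assms(1) \<open>e / 2 > 0\<close> unfolding unconditionally_cauchy_def by blast
  obtain H where H: "finite H" "\<forall>F. finite F \<and> F \<inter> H = {} \<longrightarrow> norm (sum y F) < e / 2"
    using assms(2) \<open>e / 2 > 0\<close> unfolding unconditionally_cauchy_def by blast
  have "norm (\<Sum>n\<in>F. x n + y n) < e" if F: "finite F" "F \<inter> (G \<union> H) = {}" for F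
  proof -
    have "F \<inter> G = {}" "F \<inter> H = {}" using F(2) by auto
    then have "norm (sum x F) < e / 2" "norm (sum y F) < e / 2"
      using F(1) G(2) H(2) by blast+
    then show ?thesis unfolding sum.distrib using norm_triangle_ineq[of "sum x F" "sum y F"] by linarith
  qed
  then show "\<exists>G. finite G \<and> (\<forall>F. finite F \<and> F \<inter> G = {} \<longrightarrow> norm (\<Sum>n\<in>F. x n + y n) < e)"
    using G(1) H(1) by (intro exI[of _ "G \<union> H"]) auto
qed

lemma unconditionally_cauchy_scaleC:
  fixes x :: "'i \<Rightarrow> 'x::complex_normed_vector"
  assumes x: "unconditionally_cauchy x"
  shows "unconditionally_cauchy (\<lambda>n. c *\<^sub>C x n)"
  unfolding unconditionally_cauchy_def
proof (intro allI impI)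
  fix e :: real assume "e > 0"
  moreover have pos: "cmod c + 1 > 0" by (simp add: add_nonneg_pos)
  ultimately have "e / (cmod c + 1) > 0" by simp
  then obtain G where G: "finite G" "\<forall>F. finite F \<and> F \<inter> G = {} \<longrightarrow> norm (sum x F) < e / (cmod c + 1)"
    using x unfolding unconditionally_cauchy_def by blast
  have "norm (\<Sum>n\<in>F. c *\<^sub>C x n) < e" if "finite F" "F \<inter> G = {}" for F
  proof -
    have "norm (\<Sum>n\<in>F. c *\<^sub>C x n) = cmod c * norm (sum x F)"
      by (simp add: norm_scaleC flip: complex_vector.scale_sum_right)
    also have "\<dots> \<le> (cmod c + 1) * norm (sum x F)" by (intro mult_right_mono) auto
    also have "\<dots> < (cmod c + 1) * (e / (cmod c + 1))"
      using G(2) that pos by (intro mult_strict_left_mono) auto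
    also have "\<dots> = e" using pos by simp
    finally show ?thesis .
  qed
  then show "\<exists>G. finite G \<and> (\<forall>F. finite F \<and> F \<inter> G = {} \<longrightarrow> norm (\<Sum>n\<in>F. c *\<^sub>C x n) < e)"
    using G(1) by blast
qed

text \<open>Since \<open>S\<close> need not be injective, a backward orbit of the point is part of the data.\<close>

definition summable_orbit_points :: "('x::complex_normed_vector \<Rightarrow> 'x) \<Rightarrow> 'x set"
  where "summable_orbit_points S =
    {x. \<exists>\<psi> :: int \<Rightarrow> 'x. (\<forall>n. S (\<psi> n) = \<psi> (n + 1)) \<and> unconditionally_cauchy \<psi> \<and> \<psi> 0 = x}"

lemma csubspace_summable_orbit_points:
  assumes "bounded_clinear S"
  shows "csubspace (summable_orbit_points S)"
proof -
  have add: "S (x + y) = S x + S y" and scale: "S (c *\<^sub>C x) = c *\<^sub>C S x" and zero: "S 0 = 0" for c x y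
    using assms by (auto simp: bounded_clinear_def linear_add[OF bounded_linear.linear]
        linear_0[OF bounded_linear.linear])
  show ?thesis
    unfolding complex_vector.subspace_def
  proof (intro conjI ballI allI)
    show "0 \<in> summable_orbit_points S"
      unfolding summable_orbit_points_def
      by (auto simp: zero unconditionally_cauchy_def intro!: exI[of _ "\<lambda>_. 0"])
    fix x assume "x \<in> summable_orbit_points S"
    then obtain \<psi> :: "int \<Rightarrow> 'a" where \<psi>: "\<forall>n. S (\<psi> n) = \<psi> (n + 1)" "unconditionally_cauchy \<psi>" "\<psi> 0 = x"
      by (auto simp: summable_orbit_points_def)
    show "c *\<^sub>C x \<in> summable_orbit_points S" for c
      unfolding summable_orbit_points_def mem_Collect_eq
      by (intro exI[of _ "\<lambda>n. c *\<^sub>C \<psi> n"]) (use \<psi> in \<open>simp add: scale unconditionally_cauchy_scaleC\<close>)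
    fix y assume "y \<in> summable_orbit_points S"
    then obtain \<xi> :: "int \<Rightarrow> 'a" where \<xi>: "\<forall>n. S (\<xi> n) = \<xi> (n + 1)" "unconditionally_cauchy \<xi>" "\<xi> 0 = y"
      by (auto simp: summable_orbit_points_def)
    show "x + y \<in> summable_orbit_points S"
      unfolding summable_orbit_points_def mem_Collect_eq
      by (intro exI[of _ "\<lambda>n. \<psi> n + \<xi> n"]) (use \<psi> \<xi> in \<open>simp add: add unconditionally_cauchy_add\<close>)
  qed
qed

text \<open>The orbits are enumerated so that their points \<open>x l\<close> approximate a dense sequence, and each approximant recurs at
  arbitrarily large \<open>l\<close>, where the accuracy \<open>2 (1/2)\<^sup>l\<close> is as good as desired.\<close>

theorem frequently_hypercyclic_criterion:
  fixes T :: "real \<Rightarrow> 'a::complex_banach \<Rightarrow> 'a"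
  assumes sep: "separable_space (euclidean :: 'a topology)" and T: "C0_semigroup T"
    and dense: "closure (summable_orbit_points (T 1)) = UNIV"
  shows "frequently_hypercyclic T"
proof -
  obtain C :: "'a set" where C: "countable C" "closure C = UNIV"
    using sep unfolding separable_space_def by auto
  then have "C \<noteq> {}" by auto
  have "\<forall>c n. \<exists>y. y \<in> summable_orbit_points (T 1) \<and> dist y c < inverse (real (Suc n))"
  proof (intro allI)
    fix c :: 'a and n
    have "c \<in> closure (summable_orbit_points (T 1))" using dense by simp
    moreover have "inverse (real (Suc n)) > 0" by simp
    ultimately show "\<exists>y. y \<in> summable_orbit_points (T 1) \<and> dist y c < inverse (real (Suc n))"
      unfolding closure_approachable by blast
  qed
  then obtain Y where Y: "\<And>c n. Y c n \<in> summable_orbit_points (T 1)"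
    "\<And>c n. dist (Y c n) c < inverse (real (Suc n))"
    by metis
  \<comment> \<open>The second component of the outer pair makes every value recur at arbitrarily large \<open>l\<close>.\<close>
  define x where "x l = (case prod_decode (fst (prod_decode l)) of (i, n) \<Rightarrow> Y (from_nat_into C i) n)" for l
  have "x l \<in> summable_orbit_points (T 1)" for l
    using Y(1) by (simp add: x_def split: prod.split)
  then have "\<forall>l. \<exists>\<psi> :: int \<Rightarrow> 'a. (\<forall>n. T 1 (\<psi> n) = \<psi> (n + 1)) \<and> unconditionally_cauchy \<psi> \<and> \<psi> 0 = x l"
    by (simp add: summable_orbit_points_def)
  from choice[OF this] obtain \<psi> :: "nat \<Rightarrow> int \<Rightarrow> 'a" where
    \<psi>: "\<forall>l. (\<forall>n. T 1 (\<psi> l n) = \<psi> l (n + 1)) \<and> unconditionally_cauchy (\<psi> l) \<and> \<psi> l 0 = x l" ..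
  obtain z where z: "\<And>l. \<exists>a K. strict_mono a \<and> (\<forall>r. a r \<le> K * Suc r) \<and>
      (\<forall>r. norm ((T 1 ^^ a r) z - \<psi> l 0) \<le> 2 * (1 / 2) ^ l)"
    using orbit_approximating_sequence[of "T 1" \<psi>] \<psi> C0_semigroup_D(1)[OF T] zero_le_one by metis
  have iter: "(T 1 ^^ m) z = T (real m) z" for m
  proof (induction m)
    case 0 then show ?case by (simp add: C0_semigroup_D(3)[OF T])
  next
    case (Suc m)
    then show ?case using C0_semigroup_D(4)[OF T, of 1 "real m" z] by simp
  qed
  have "lower_density {t. 0 \<le> t \<and> T t z \<in> U} > 0" if U: "open U" "U \<noteq> {}" for U
  proof -
    obtain u where u: "u \<in> U" using U(2) by blast
    obtain \<delta> \<epsilon> where \<delta>: "0 < \<delta>" "\<delta> \<le> 1" and \<epsilon>: "0 < \<epsilon>"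
      and stay: "\<And>y s. dist y u < \<epsilon> \<Longrightarrow> 0 \<le> s \<Longrightarrow> s \<le> \<delta> \<Longrightarrow> T s y \<in> U"
      using C0_semigroup_shrink_open[OF T U(1) u] by metis
    have "u \<in> closure C" using C(2) by simp
    then obtain c where c: "c \<in> C" "dist c u < \<epsilon> / 3"
      using \<epsilon> unfolding closure_approachable by (metis zero_less_divide_iff zero_less_numeral)
    obtain i where i: "from_nat_into C i = c" using from_nat_into_surj[OF C(1) c(1)] ..
    obtain n where n: "inverse (real (Suc n)) < \<epsilon> / 3"
      using \<epsilon> reals_Archimedean[of "\<epsilon> / 3"] by auto
    obtain r where r: "(1 / 2 :: real) ^ r < \<epsilon> / 6"
      using \<epsilon> real_arch_pow_inv[of "\<epsilon> / 6" "1 / 2"] by auto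
    define l where "l = prod_encode (prod_encode (i, n), r)"
    have "r \<le> l" unfolding l_def by (rule le_prod_encode_2)
    then have "(1 / 2 :: real) ^ l \<le> (1 / 2) ^ r" by (intro power_decreasing) auto
    then have small: "2 * (1 / 2 :: real) ^ l < \<epsilon> / 3" using r by linarith
    have \<psi>Y: "\<psi> l 0 = Y c n" using \<psi> by (simp add: x_def l_def i)
    have near: "dist (\<psi> l 0) u < 2 * \<epsilon> / 3"
      unfolding \<psi>Y using Y(2)[of c n] n c(2) dist_triangle[of "Y c n" u c] by linarith
    obtain a K where a: "strict_mono a" "\<forall>r. a r \<le> K * Suc r"
      "\<forall>r. norm ((T 1 ^^ a r) z - \<psi> l 0) \<le> 2 * (1 / 2) ^ l"
      using z[of l] by blast
    show ?thesis
    proof (rule lower_density_pos[OF _ a(1) _ \<delta>])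
      have "continuous_on {0..} (\<lambda>t. T t z)" by (rule C0_semigroup_D(5)[OF T])
      then obtain A where A: "open A" "A \<inter> {0..} = (\<lambda>t. T t z) -` U \<inter> {0..}"
        using U(1) unfolding continuous_on_open_invariant by blast
      have "{t. 0 \<le> t \<and> T t z \<in> U} = A \<inter> {0..}" using A(2) by auto
      then show "{t. 0 \<le> t \<and> T t z \<in> U} \<in> sets lebesgue"
        using A(1) by (simp add: sets.Int)
      show "a r \<le> K * Suc r" for r using a(2) by blast
      show "{real (a r)..real (a r) + \<delta>} \<subseteq> {t. 0 \<le> t \<and> T t z \<in> U}" for r
      proof
        fix t assume t: "t \<in> {real (a r)..real (a r) + \<delta>}"
        have "dist (T (real (a r)) z) (\<psi> l 0) < \<epsilon> / 3"
          using a(3)[rule_format, of r] small by (simp add: dist_norm iter)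
        then have "dist (T (real (a r)) z) u < \<epsilon>"
          using near dist_triangle[of "T (real (a r)) z" u "\<psi> l 0"] by linarith
        then have "T (t - real (a r)) (T (real (a r)) z) \<in> U" using t by (intro stay) auto
        moreover have "T t z = T (t - real (a r)) (T (real (a r)) z)"
          using C0_semigroup_D(4)[OF T, of "t - real (a r)" "real (a r)" z] t by simp
        ultimately show "t \<in> {t. 0 \<le> t \<and> T t z \<in> U}" using t by simp
      qed
    qed
  qed
  then show ?thesis unfolding frequently_hypercyclic_def by blast
qed

section \<open>Wave packets of eigenvectors\<close>

lemma C1_onE:
  assumes "Ck_on 1 X g"
  obtains g' where "\<And>t. t \<in> X \<Longrightarrow> (g has_vector_derivative g' t) (at t within X)"
    "continuous_on X g'"
proof -
  obtain g' where "(\<forall>t\<in>X. (g has_vector_derivative g' t) (at t within X)) \<and> continuous_on X g'"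
    using assms unfolding One_nat_def Ck_on.simps ..
  then show thesis by (intro that[of g']) blast+
qed

text \<open>The difference quotients are weakly bounded by the mean value inequality, hence bounded in norm, and \<open>f\<close> is
  Lipschitz continuous.\<close>

lemma weakly_C1_imp_continuous:
  fixes f :: "real \<Rightarrow> 'a::complex_banach"
  assumes weak: "\<And>\<phi>. \<phi> \<in> dual \<Longrightarrow> Ck_on 1 {a..b} (\<lambda>t. \<phi> (f t))"
  shows "continuous_on {a..b} f"
proof -
  define V where "V = {(f t - f s) /\<^sub>R (t - s) | t s. t \<in> {a..b} \<and> s \<in> {a..b}}"
  have "\<exists>C\<ge>0. \<forall>v\<in>V. norm v \<le> C"
  proof (rule weakly_bounded_imp_bounded)
    fix \<phi> :: "'a \<Rightarrow> complex" assume \<phi>: "\<phi> \<in> dual"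
    then interpret \<phi>: bounded_linear \<phi> by (simp add: dual_def bounded_clinear_def)
    obtain g where g: "\<And>t. t \<in> {a..b} \<Longrightarrow> ((\<lambda>t. \<phi> (f t)) has_vector_derivative g t) (at t within {a..b})"
      "continuous_on {a..b} g"
      using C1_onE[OF weak[OF \<phi>]] by metis
    have "bounded (g ` {a..b})" by (intro compact_imp_bounded compact_continuous_image g) simp
    then obtain B where B: "B > 0" "\<And>t. t \<in> {a..b} \<Longrightarrow> norm (g t) \<le> B"
      by (auto simp: bounded_pos)
    have lip: "cmod (\<phi> (f t) - \<phi> (f s)) \<le> B * norm (t - s)" if "t \<in> {a..b}" "s \<in> {a..b}" for t s
    proof (rule differentiable_bound[of "{a..b}" "\<lambda>t. \<phi> (f t)" "\<lambda>t h. h *\<^sub>R g t"])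
      show "onorm (\<lambda>h. h *\<^sub>R g t) \<le> B" if "t \<in> {a..b}" for t
        using B(1) B(2)[OF that] by (intro onorm_bound) (auto simp: mult.commute[of B] mult_left_mono)
    qed (use g(1) that in \<open>auto simp: has_vector_derivative_def\<close>)
    have "cmod (\<phi> v) \<le> B" if "v \<in> V" for v
    proof -
      obtain t s where ts: "v = (f t - f s) /\<^sub>R (t - s)" "t \<in> {a..b}" "s \<in> {a..b}"
        using \<open>v \<in> V\<close> by (auto simp: V_def)
      show ?thesis
      proof (cases "t = s")
        case False
        have "cmod (\<phi> v) = cmod (\<phi> (f t) - \<phi> (f s)) / \<bar>t - s\<bar>"
          unfolding ts(1) \<phi>.scaleR \<phi>.diff by (simp add: divide_inverse mult.commute)
        then show ?thesis using lip[OF ts(2,3)] False by (simp add: divide_le_eq)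
      qed (use B ts in \<open>simp add: \<phi>.zero\<close>)
    qed
    then show "\<exists>B. \<forall>v\<in>V. cmod (\<phi> v) \<le> B" by blast
  qed
  then obtain C where C: "C \<ge> 0" "\<And>v. v \<in> V \<Longrightarrow> norm v \<le> C" by blast
  have "dist (f t) (f s) \<le> C * dist t s" if ts: "t \<in> {a..b}" "s \<in> {a..b}" for t s
  proof (cases "t = s")
    case False
    have "norm ((f t - f s) /\<^sub>R (t - s)) \<le> C" using ts by (intro C(2)) (auto simp: V_def)
    then have "norm (f t - f s) / \<bar>t - s\<bar> \<le> C" by (simp add: divide_inverse mult.commute)
    then show ?thesis using False by (simp add: dist_norm divide_le_eq)
  qed simp
  then show ?thesis using C(1) by (intro lipschitz_on_continuous_on[OF lipschitz_onI])
qed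

text \<open>The zeros at both ends of the interval are double, so that two integrations by parts leave no boundary terms.\<close>

definition bump :: "real \<Rightarrow> real \<Rightarrow> real \<Rightarrow> real"
  where "bump a b s = ((s - a) * (b - s))\<^sup>2"

lemma has_real_derivative_bump:
  "(bump a b has_real_derivative 2 * (s - a) * (b - s) * (a + b - 2 * s)) (at s within X)"
  unfolding bump_def
  by (auto intro!: derivative_eq_intros simp: algebra_simps power2_eq_square)

lemma continuous_on_bump [continuous_intros]: "continuous_on X (bump a b)"
  unfolding bump_def by (intro continuous_intros)

definition wave_packet :: "real \<Rightarrow> real \<Rightarrow> (real \<Rightarrow> 'a::complex_banach) \<Rightarrow> int \<Rightarrow> 'a"
  where "wave_packet a b f n = integral {a..b} (\<lambda>s. cis (of_int n * s) *\<^sub>C (bump a b s *\<^sub>R f s))"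

lemma wave_packet_integrable:
  fixes f :: "real \<Rightarrow> 'a::complex_banach"
  assumes "continuous_on {a..b} f"
  shows "(\<lambda>s. cis (of_int n * s) *\<^sub>C (bump a b s *\<^sub>R f s)) integrable_on {a..b}"
  by (intro integrable_continuous_real continuous_intros assms)

lemma wave_packet_C2:
  fixes f :: "real \<Rightarrow> 'a::complex_banach"
  assumes ab: "a \<le> b" and f: "Ck_on 2 {a..b} f"
  shows "unconditionally_cauchy (wave_packet a b f)"
proof -
  obtain f' where f': "\<And>s. s \<in> {a..b} \<Longrightarrow> (f has_vector_derivative f' s) (at s within {a..b})"
    and "Ck_on 1 {a..b} f'"
  proof -
    obtain f' where "(\<forall>s\<in>{a..b}. (f has_vector_derivative f' s) (at s within {a..b})) \<and> Ck_on (Suc 0) {a..b} f'"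
      using f unfolding numeral_2_eq_2 Ck_on.simps(2)[of "Suc 0"] ..
    then show thesis by (intro that[of f']) auto
  qed
  then obtain f'' where f'': "\<And>s. s \<in> {a..b} \<Longrightarrow> (f' has_vector_derivative f'' s) (at s within {a..b})"
    and cont: "continuous_on {a..b} f''"
    using C1_onE by metis
  define w1 where "w1 s = 2 * (s - a) * (b - s) * (a + b - 2 * s)" for s
  define w2 where "w2 s = 2 * (a + b - 2 * s)\<^sup>2 - 4 * (s - a) * (b - s)" for s
  have w: "(bump a b has_real_derivative w1 s) (at s within {a..b})" for s
    unfolding w1_def by (rule has_real_derivative_bump)
  have w1: "(w1 has_real_derivative w2 s) (at s within {a..b})" for s
    unfolding w1_def w2_def
    by (auto intro!: derivative_eq_intros simp: algebra_simps power2_eq_square)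
  have cf: "continuous_on {a..b} f" "continuous_on {a..b} f'"
    using f' f'' has_vector_derivative_continuous
    unfolding continuous_on_eq_continuous_within by blast+
  show ?thesis
    unfolding wave_packet_def[abs_def]
  proof (rule fourier_coefficients_C2[OF ab])
    fix s assume s: "s \<in> {a..b}"
    show "((\<lambda>s. bump a b s *\<^sub>R f s) has_vector_derivative (bump a b s *\<^sub>R f' s + w1 s *\<^sub>R f s)) (at s within {a..b})"
      by (rule has_vector_derivative_scaleR[OF w f'[OF s]])
    show "((\<lambda>s. bump a b s *\<^sub>R f' s + w1 s *\<^sub>R f s) has_vector_derivative
        ((bump a b s *\<^sub>R f'' s + w1 s *\<^sub>R f' s) + (w1 s *\<^sub>R f' s + w2 s *\<^sub>R f s))) (at s within {a..b})"
      by (rule has_vector_derivative_add[OF has_vector_derivative_scaleR[OF w f''[OF s]]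
            has_vector_derivative_scaleR[OF w1 f'[OF s]]])
  next
    show "continuous_on {a..b} (\<lambda>s. (bump a b s *\<^sub>R f'' s + w1 s *\<^sub>R f' s) + (w1 s *\<^sub>R f' s + w2 s *\<^sub>R f s))"
      unfolding w1_def w2_def by (intro continuous_intros cont cf)
  qed (auto simp: bump_def w1_def)
qed

lemma wave_packet_weakly_C1:
  fixes f :: "real \<Rightarrow> 'a::complex_banach"
  assumes ab: "a \<le> b" "b \<le> a + 2 * pi" and no_c0: "\<not> contains_c0 TYPE('a)"
    and weak: "\<And>\<phi>. \<phi> \<in> dual \<Longrightarrow> Ck_on 1 {a..b} (\<lambda>t. \<phi> (f t))"
  shows "unconditionally_cauchy (wave_packet a b f)"
proof (rule bessaga_pelczynski[OF no_c0])
  fix \<phi> :: "'a \<Rightarrow> complex" assume \<phi>: "\<phi> \<in> dual"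
  then interpret \<phi>: bounded_linear \<phi> by (simp add: dual_def bounded_clinear_def)
  have \<phi>_scale: "\<phi> (c *\<^sub>C v) = c * \<phi> v" for c v
    using \<phi> by (simp add: dual_def bounded_clinear_def scaleC_complex_def)
  obtain g where g: "\<And>t. t \<in> {a..b} \<Longrightarrow> ((\<lambda>t. \<phi> (f t)) has_vector_derivative g t) (at t within {a..b})"
    "continuous_on {a..b} g"
    using C1_onE[OF weak[OF \<phi>]] by metis
  have f_cont: "continuous_on {a..b} f" by (rule weakly_C1_imp_continuous[OF weak])
  define w1 where "w1 s = 2 * (s - a) * (b - s) * (a + b - 2 * s)" for s
  have w: "(bump a b has_real_derivative w1 s) (at s within {a..b})" for s
    unfolding w1_def by (rule has_real_derivative_bump)
  obtain B where B: "\<And>F :: int set. finite F \<Longrightarrow>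
      (\<Sum>n\<in>F. cmod (integral {a..b} (\<lambda>s. cis (of_int n * s) * (bump a b s *\<^sub>R \<phi> (f s))))) \<le> B"
  proof (rule fourier_coefficients_summable[OF ab])
    show "((\<lambda>s. bump a b s *\<^sub>R \<phi> (f s)) has_vector_derivative (bump a b s *\<^sub>R g s + w1 s *\<^sub>R \<phi> (f s)))
        (at s within {a..b})" if "s \<in> {a..b}" for s
      by (rule has_vector_derivative_scaleR[OF w g(1)[OF that]])
    show "continuous_on {a..b} (\<lambda>s. bump a b s *\<^sub>R g s + w1 s *\<^sub>R \<phi> (f s))"
      unfolding w1_def by (intro continuous_intros g \<phi>.continuous_on f_cont)
  qed (auto simp: bump_def)
  have "\<phi> (wave_packet a b f n) = integral {a..b} (\<lambda>s. cis (of_int n * s) * (bump a b s *\<^sub>R \<phi> (f s)))" for n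
    unfolding wave_packet_def
    using integral_linear[OF wave_packet_integrable[OF f_cont, of n] \<phi>.bounded_linear_axioms]
    by (simp add: o_def \<phi>_scale \<phi>.scaleR)
  then show "\<exists>B. \<forall>F. finite F \<longrightarrow> (\<Sum>n\<in>F. cmod (\<phi> (wave_packet a b f n))) \<le> B"
    using B by auto
qed

text \<open>The operator multiplies the integrand at \<open>s\<close> by \<open>e\<^sup>i\<^sup>s\<close> and so shifts the packets. The packet at \<open>0\<close>, divided by the integral
  of the weight, is an average of values of \<open>f\<close>.\<close>

lemma eigenvector_average:
  fixes f :: "real \<Rightarrow> 'a::complex_banach"
  assumes S: "bounded_clinear S" and ab: "a < b"
    and eig: "\<And>s. s \<in> {a..b} \<Longrightarrow> S (f s) = cis s *\<^sub>C f s" and cont: "continuous_on {a..b} f"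
    and unc: "unconditionally_cauchy (wave_packet a b f)"
    and near: "\<And>s. s \<in> {a..b} \<Longrightarrow> dist (f s) v \<le> e"
  shows "\<exists>x \<in> summable_orbit_points S. dist x v \<le> e"
proof -
  have lin: "bounded_linear S" and scale: "S (c *\<^sub>C x) = c *\<^sub>C S x" for c x
    using S by (auto simp: bounded_clinear_def)
  interpret S: bounded_linear S by (rule lin)
  have "S (wave_packet a b f n) = wave_packet a b f (n + 1)" for n
  proof -
    have "S (wave_packet a b f n) = integral {a..b} (\<lambda>s. S (cis (of_int n * s) *\<^sub>C (bump a b s *\<^sub>R f s)))"
      unfolding wave_packet_def
      using integral_linear[OF wave_packet_integrable[OF cont, of n] lin] by (simp add: o_def)
    also have "\<dots> = wave_packet a b f (n + 1)"
      unfolding wave_packet_def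
    proof (rule integral_cong)
      fix s assume "s \<in> {a..b}"
      then show "S (cis (of_int n * s) *\<^sub>C (bump a b s *\<^sub>R f s)) = cis (of_int (n + 1) * s) *\<^sub>C (bump a b s *\<^sub>R f s)"
        by (simp add: scale S.scaleR eig scaleC_scaleR_right[symmetric] scaleC_scaleC cis_mult algebra_simps)
    qed
    finally show ?thesis .
  qed
  then have P: "wave_packet a b f 0 \<in> summable_orbit_points S"
    unfolding summable_orbit_points_def using unc by blast
  define W where "W = integral {a..b} (bump a b)"
  have bump_int: "bump a b integrable_on {a..b}"
    by (intro integrable_continuous_real continuous_intros)
  have "W \<ge> 0" unfolding W_def by (intro integral_nonneg bump_int) (simp add: bump_def)
  moreover have "W \<noteq> 0"
  proof
    assume "W = 0"
    then have "\<forall>s\<in>{a..b}. bump a b s = 0"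
      unfolding W_def using ab
      by (subst integral_eq_0_iff[symmetric]) (auto intro!: continuous_intros simp: bump_def)
    then have "bump a b ((a + b) / 2) = 0" using ab by auto
    moreover have "(a + b) / 2 - a \<noteq> 0" "b - (a + b) / 2 \<noteq> 0" using ab by (simp_all add: field_simps)
    ultimately show False by (simp add: bump_def)
  qed
  ultimately have W: "W > 0" by simp
  have "norm (wave_packet a b f 0 - W *\<^sub>R v) \<le> e * W"
  proof -
    have "wave_packet a b f 0 - W *\<^sub>R v = integral {a..b} (\<lambda>s. bump a b s *\<^sub>R f s) - integral {a..b} (\<lambda>s. bump a b s *\<^sub>R v)"
      using integral_linear[OF bump_int bounded_linear_scaleR_left[of v]]
      by (simp add: wave_packet_def W_def o_def)
    also have "\<dots> = integral {a..b} (\<lambda>s. bump a b s *\<^sub>R (f s - v))"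
      by (subst integral_diff[symmetric])
         (auto intro!: integrable_continuous_real continuous_intros cont simp: scaleR_diff_right)
    also have "norm \<dots> \<le> integral {a..b} (\<lambda>s. e * bump a b s)"
    proof (rule integral_norm_bound_integral)
      show "norm (bump a b s *\<^sub>R (f s - v)) \<le> e * bump a b s" if "s \<in> {a..b}" for s
        using near[OF that] by (simp add: dist_norm bump_def mult.commute mult_right_mono)
    qed (intro integrable_continuous_real continuous_intros cont)+
    also have "\<dots> = e * W" by (simp add: W_def)
    finally show ?thesis .
  qed
  moreover have "wave_packet a b f 0 - W *\<^sub>R v = W *\<^sub>R ((1 / W) *\<^sub>R wave_packet a b f 0 - v)"
    using W by (simp add: scaleR_diff_right)
  ultimately have "dist ((1 / W) *\<^sub>R wave_packet a b f 0) v \<le> e"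
    using W by (simp add: dist_norm)
  moreover have "(1 / W) *\<^sub>R wave_packet a b f 0 \<in> summable_orbit_points S"
    unfolding scaleC_of_real[symmetric]
    by (intro complex_vector.subspace_scale[OF csubspace_summable_orbit_points[OF S]] P)
  ultimately show ?thesis by blast
qed

lemma Ck_on_subset: "Ck_on k X g \<Longrightarrow> Y \<subseteq> X \<Longrightarrow> Ck_on k Y g"
proof (induction k arbitrary: g)
  case 0 then show ?case by (auto intro: continuous_on_subset)
next
  case (Suc k)
  then show ?case by (simp, metis has_vector_derivative_within_subset subsetD)
qed

lemma nondegenerate_interval_one_sided:
  assumes I: "nondegenerate_interval I" "t \<in> I"
  obtains d where "d > 0" "{t..t + d} \<subseteq> I \<or> {t - d..t} \<subseteq> I"
proof -
  obtain c0 where "c0 \<in> interior I" using I by (auto simp: nondegenerate_interval_def)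
  then obtain e where e: "e > 0" "cball c0 e \<subseteq> I" by (auto simp: mem_interior_cball)
  define c where "c = (if c0 = t then c0 + e else c0)"
  have c: "c \<in> I" "c \<noteq> t" using e by (auto simp: c_def dist_real_def subset_iff)
  have I': "\<And>u v x. u \<in> I \<Longrightarrow> v \<in> I \<Longrightarrow> u \<le> x \<Longrightarrow> x \<le> v \<Longrightarrow> x \<in> I"
    using I(1) unfolding nondegenerate_interval_def is_interval_1 by blast
  show thesis
  proof (cases "t < c")
    case True
    then show thesis using I'[OF I(2) c(1)] by (intro that[of "c - t"]) auto
  next
    case False
    then show thesis using I'[OF c(1) I(2)] c(2) by (intro that[of "t - c"]) auto
  qed
qed

lemma csubspace_closure:
  fixes G :: "'x::complex_normed_vector set"
  assumes G: "csubspace G"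
  shows "csubspace (closure G)"
  unfolding complex_vector.subspace_def
proof (intro conjI ballI allI)
  show "0 \<in> closure G" using complex_vector.subspace_0[OF G] closure_subset by blast
  fix x assume "x \<in> closure G"
  then obtain u where u: "\<And>n. u n \<in> G" "u \<longlonglongrightarrow> x" unfolding closure_sequential by blast
  have "(\<lambda>n. c *\<^sub>C u n) \<longlonglongrightarrow> c *\<^sub>C x" for c by (intro tendsto_intros u)
  then show "c *\<^sub>C x \<in> closure G" for c
    unfolding closure_sequential
    by (intro exI[of _ "\<lambda>n. c *\<^sub>C u n"] conjI allI complex_vector.subspace_scale[OF G] u(1))
  fix y assume "y \<in> closure G"
  then obtain v where v: "\<And>n. v n \<in> G" "v \<longlonglongrightarrow> y" unfolding closure_sequential by blast
  have "(\<lambda>n. u n + v n) \<longlonglongrightarrow> x + y" by (intro tendsto_intros u v)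
  then show "x + y \<in> closure G"
    unfolding closure_sequential
    by (intro exI[of _ "\<lambda>n. u n + v n"] conjI allI complex_vector.subspace_add[OF G] u(1) v(1))
qed

theorem corollary2p3:
  fixes T :: "real \<Rightarrow> 'a::complex_banach \<Rightarrow> 'a"
    and \<Gamma> :: "'j set"
    and I :: "'j \<Rightarrow> real set"
    and f :: "'j \<Rightarrow> real \<Rightarrow> 'a"
  assumes separable: "separable_space (euclidean :: 'a topology)"
    and semigroup: "C0_semigroup T"
    and interval: "\<And>j. j \<in> \<Gamma> \<Longrightarrow> nondegenerate_interval (I j)"
    and measurable: "\<And>j. j \<in> \<Gamma> \<Longrightarrow> f j \<in> borel_measurable (lebesgue_on (I j))"
    and locally_bounded: "\<And>j. j \<in> \<Gamma> \<Longrightarrow> locally_bounded_on (I j) (f j)"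
    and eigenvector: "\<And>j t. j \<in> \<Gamma> \<Longrightarrow> t \<in> I j \<Longrightarrow>
      f j t \<in> generator_domain T \<and> generator T (f j t) = (\<i> * complex_of_real t) *\<^sub>C f j t"
    and dense: "closure (cspan {f j t | j t. j \<in> \<Gamma> \<and> t \<in> I j}) = UNIV"
    and smooth: "(\<forall>j\<in>\<Gamma>. Ck_on 2 (I j) (f j)) \<or>
      (\<not> contains_c0 TYPE('a) \<and>
        (\<forall>\<phi>\<in>dual. \<forall>j\<in>\<Gamma>. Ck_on 1 (I j) (\<lambda>t. \<phi> (f j t))))"
  shows "frequently_hypercyclic T"
proof (rule frequently_hypercyclic_criterion[OF separable semigroup])
  let ?G = "summable_orbit_points (T 1)"
  have T1: "bounded_clinear (T 1)" using semigroup by (simp add: C0_semigroup_def)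
  have eig: "T 1 (f j s) = cis s *\<^sub>C f j s" if "j \<in> \<Gamma>" "s \<in> I j" for j s
    using generator_eigenvector_orbit[OF semigroup] eigenvector[OF that] by blast
  have cont: "continuous_on {a..b} (f j)" if j: "j \<in> \<Gamma>" and ab: "{a..b} \<subseteq> I j" for j a b
    using smooth
  proof
    assume "\<forall>j\<in>\<Gamma>. Ck_on 2 (I j) (f j)"
    then have "Ck_on 2 {a..b} (f j)" using Ck_on_subset ab j by blast
    then show ?thesis
      unfolding numeral_2_eq_2 Ck_on.simps(2)[of "Suc 0"] continuous_on_eq_continuous_within
      by (blast intro: has_vector_derivative_continuous)
  next
    assume weak: "\<not> contains_c0 TYPE('a) \<and> (\<forall>\<phi>\<in>dual. \<forall>j\<in>\<Gamma>. Ck_on 1 (I j) (\<lambda>t. \<phi> (f j t)))"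
    show ?thesis
    proof (rule weakly_C1_imp_continuous)
      fix \<phi> :: "'a \<Rightarrow> complex" assume "\<phi> \<in> dual"
      then show "Ck_on 1 {a..b} (\<lambda>t. \<phi> (f j t))" using Ck_on_subset[OF _ ab] weak j by blast
    qed
  qed
  have packet: "unconditionally_cauchy (wave_packet a b (f j))"
    if j: "j \<in> \<Gamma>" and ab: "{a..b} \<subseteq> I j" "a \<le> b" "b \<le> a + 2 * pi" for j a b
    using smooth
  proof
    assume "\<forall>j\<in>\<Gamma>. Ck_on 2 (I j) (f j)"
    then have "Ck_on 2 {a..b} (f j)" using Ck_on_subset ab j by blast
    then show ?thesis by (rule wave_packet_C2[OF ab(2)])
  next
    assume weak: "\<not> contains_c0 TYPE('a) \<and> (\<forall>\<phi>\<in>dual. \<forall>j\<in>\<Gamma>. Ck_on 1 (I j) (\<lambda>t. \<phi> (f j t)))"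
    show ?thesis
    proof (rule wave_packet_weakly_C1[OF ab(2,3)])
      show "\<not> contains_c0 TYPE('a)" using weak ..
      fix \<phi> :: "'a \<Rightarrow> complex" assume "\<phi> \<in> dual"
      then show "Ck_on 1 {a..b} (\<lambda>t. \<phi> (f j t))" using Ck_on_subset[OF _ ab(1)] weak j by blast
    qed
  qed
  have local: "f j t \<in> closure ?G"
    if j: "j \<in> \<Gamma>" and ab: "{a..b} \<subseteq> I j" "a < b" and t: "t = a \<or> t = b" for j t a b
    unfolding closure_approachable_le
  proof (intro allI impI)
    fix e :: real assume e: "e > 0"
    have "t \<in> {a..b}" using t ab(2) by auto
    then obtain \<delta> where \<delta>: "\<delta> > 0" "\<forall>s\<in>{a..b}. dist s t < \<delta> \<longrightarrow> dist (f j s) (f j t) < e"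
      using cont[OF j ab(1)] e unfolding continuous_on_iff by blast
    \<comment> \<open>The interval is shrunk towards \<open>t\<close>, which remains one of its end points. Length at most \<open>1\<close> keeps it within
      one period.\<close>
    define \<eta> where "\<eta> = min (b - a) (min 1 (\<delta> / 2))"
    define a' where "a' = (if t = a then a else b - \<eta>)"
    have \<eta>: "0 < \<eta>" "\<eta> \<le> b - a" "\<eta> \<le> 1" "\<eta> < \<delta>" using ab(2) \<delta>(1) by (auto simp: \<eta>_def)
    have sub: "{a'..a' + \<eta>} \<subseteq> {a..b}" using \<eta> t by (auto simp: a'_def)
    have near: "dist (f j s) (f j t) \<le> e" if s: "s \<in> {a'..a' + \<eta>}" for s
    proof -
      have "dist s t < \<delta>" using s t \<eta> by (auto simp: a'_def dist_real_def split: if_splits)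
      then show ?thesis using \<delta>(2) sub s by (meson less_imp_le subsetD)
    qed
    have "\<eta> \<le> 2 * pi" using \<eta>(3) pi_ge_two by linarith
    then show "\<exists>x\<in>?G. dist x (f j t) \<le> e"
      using \<eta>(1) sub ab(1) j near
      by (intro eigenvector_average[OF T1, of a' "a' + \<eta>" "f j"] eig cont packet) auto
  qed
  have "{f j t | j t. j \<in> \<Gamma> \<and> t \<in> I j} \<subseteq> closure ?G"
  proof clarify
    fix j t assume j: "j \<in> \<Gamma>" "t \<in> I j"
    obtain d where "d > 0" "{t..t + d} \<subseteq> I j \<or> {t - d..t} \<subseteq> I j"
      using nondegenerate_interval_one_sided[OF interval[OF j(1)] j(2)] by metis
    then show "f j t \<in> closure ?G"
      using local[OF j(1), of t "t + d" t] local[OF j(1), of "t - d" t t] by auto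
  qed
  then have "cspan {f j t | j t. j \<in> \<Gamma> \<and> t \<in> I j} \<subseteq> closure ?G"
    by (intro complex_vector.span_minimal csubspace_closure csubspace_summable_orbit_points T1)
  then have "closure (cspan {f j t | j t. j \<in> \<Gamma> \<and> t \<in> I j}) \<subseteq> closure ?G"
    by (rule closure_minimal) simp
  then show "closure ?G = UNIV" using dense by auto
qed

end
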